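(* Consider the problem of minimizing the transmission completion time $T$ by which $B_1$ bits are delivered to user 1 and $B_2$ bits to user 2 over a two-user AWGN broadcast channel with an energy harvesting transmitter, as set up in the context. The algorithm described in the context is feasible and optimal. That is, the power allocations it makes in each step satisfy the energy causality constraint (feasibility), and the policy it produces attains the minimum transmission completion time of $(B_1,B_2)$ (optimality).
   Context: **Channel.** Two-user AWGN broadcast channel with noise variances $1$ (user 1, stronger) and $\sigma^2>1$ (user 2, weaker). Put $f(p)=\tfrac12\log_2(1+p)$. If total power $P$ is split as $p_1$ to user 1 and $P-p_1$ to user 2, the rates are $r_1=f(p_1)$ and $r_2=f\left(\frac{P-p_1}{p_1+\sigma^2}\right)$; equivalently, the total power needed for rates $(r_1,r_2)$ is $g(r_1,r_2)=2^{2(r_1+r_2)}+(\sigma^2-1)2^{2r_2}-\sigma^2$. **Energy and policies.** Energy $E_k$ is harvested at time $s_k$, $0=s_0<s_1<s_2<\cdots$; all arrival times and amounts are known in advance, and all $B_1$ and $B_2$ bits are available at time $0$. Energy causality: at any time $t$ the total energy consumed up to $t$ is at most the total energy harvested before $t$, $\sum_{i:s_i<t}E_i$. Policies use nonnegative rates that are constant between consecutive energy arrivals. For a time $T$, $N(T)-1$ is the number of energy arrivals in $(0,T)$. The minimum transmission completion time of $(B_1,B_2)$ is the smallest $T$ such that some policy on $[0,T)$ satisfying energy causality delivers $B_1$ bits to user 1 and $B_2$ bits to user 2. **Total power for a fixed deadline $T$.** Put $N=N(T)$ and regard $s_N$ as equal to $T$. Let $i_0=0$ and, recursively, $i_n=\arg\min_{i_{n-1}<i\le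 N}\frac{\sum_{j=i_{n-1}}^{i-1}E_j}{s_i-s_{i_{n-1}}}$. The total power is $P_n=\frac{\sum_{j=i_{n-1}}^{i_n-1}E_j}{s_{i_n}-s_{i_{n-1}}}$ on $[s_{i_{n-1}},s_{i_n})$. For a constant power $P_c$ given to user 1 over the whole duration $[0,T)$, with the remaining power given to user 2, the number of bits delivered to user 2 by $T$ is $$D_2(T,P_c)=\sum_n \tfrac12\log_2\left(1+\frac{P_n-P_c}{P_c+\sigma^2}\right)(s_{i_n}-s_{i_{n-1}}).$$ **Algorithm.** Step 1. Compute $A_i=g\left(\frac{B_1}{s_i},\frac{B_2}{s_i}\right)s_i$ for $i=1,2,\dots$, the energy required to finish $(B_1,B_2)$ by $s_i$ at constant rates, and compare it with $\sum_{j=0}^{i-1}E_j$, until the first $A_i$ that is smaller than $\sum_{j=0}^{i-1}E_j$; denote this index by $\tilde i_1$. Let $\tilde T$ be the solution $T$ of $g\left(\frac{B_1}{T},\frac{B_2}{T}\right)T=\sum_{j=0}^{\tilde i_1-1}E_j$, and let $\tilde P_1$ be the corresponding constant power, $\tilde P_1=\frac1{\tilde T}\sum_{j=0}^{\tilde i_1-1}E_j$. If the constant power $\tilde P_1$ on $[0,\tilde T)$ is feasible for the actual energy arrival times, the completion time is $\tilde T$, with constant rates $(B_1/\tilde T,B_2/\tilde T)$, and the algorithm ends. Step 2. Otherwise, draw all the lines from the origin (time $0$, energy $0$) to the corner points $\left(s_i,\sum_{j=0}^{i-1}E_j\right)$ of the energy arrival instances $s_i$ before $\tilde T$, and choose the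 one with the smallest slope. This slope is $P_1$, and $s_{i_1}$ is the corresponding instant; $P_1$ is the total power on $[0,s_{i_1})$. Step 3. Tentatively assume that user 1 has constant power $P_c=P_1$. Put $T_1=\frac{B_1}{f(P_1)}$ and compute $D_2(T_1,P_1)$ from the total power for deadline $T_1$. Step 3a. If $D_2(T_1,P_1)$ is smaller than $B_2$, then user 1 is given a constant power $P_c<P_1$, where $P_c$ is the unique solution of $B_2=D_2\left(\frac{B_1}{f(P_c)},P_c\right)$ (found by bisection). The completion time is $T=\frac{B_1}{f(P_c)}$; the total power is the one for deadline $T$, and user 2 gets the power remaining after $P_c$ is given to user 1. Step 3b. If $D_2(T_1,P_1)$ is larger than $B_2$, then on $[0,s_{i_1})$ the entire power $P_1$ is allocated to user 1, and the procedure is repeated for the problem of transmitting $(B_1',B_2)$ bits starting at time $s_{i_1}$, where $B_1'=B_1-f(P_1)s_{i_1}$. If $K$ such recursions are needed to get the cut-off power $P_c$, with powers $P_1,\dots,P_K$ on the successive intervals $[s_{i_{k-1}},s_{i_k})$ ($i_0=0$), the completion time is $T=s_{i_K}+\frac{B_1-\sum_{k=1}^K f(P_k)(s_{i_k}-s_{i_{k-1}})}{f(P_c)}$.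
   Formalization: Step 2 takes the corners at s_1,…,s_{ĩ_1−1} instead of arrivals before T̃ (these differ if T̃ ≤ s_{ĩ_1−1}, where there may be no corner to choose), and in Step 3, when D_2(T_1,P_1)=B_2, a case left open, P_c=P_1 is final. *)

theory Defs
  imports Complex_Main
begin

text \<open>
  Throughout, \<open>\<sigma>2\<close> is the noise variance of user 2, \<open>s k\<close> is the time of the \<open>k\<close>-th energy
  arrival and \<open>E k\<close> the energy harvested then. The \<open>k\<close>-th epoch is \<open>[s k, s (k + 1))\<close>. A policy is
  a pair \<open>r1\<close>, \<open>r2\<close> of rate sequences, where \<open>r1 k\<close> and \<open>r2 k\<close> are the rates used during the part
  of epoch \<open>k\<close> that precedes the horizon \<open>T\<close>; the values at epochs with \<open>T \<le> s k\<close> are irrelevant.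
\<close>

definition awgn_rate :: "real \<Rightarrow> real" where
  "awgn_rate p = 1 / 2 * log 2 (1 + p)"

definition user2_rate :: "real \<Rightarrow> real \<Rightarrow> real \<Rightarrow> real" where
  "user2_rate \<sigma>2 P p1 = awgn_rate ((P - p1) / (p1 + \<sigma>2))"

definition bc_power :: "real \<Rightarrow> real \<Rightarrow> real \<Rightarrow> real" where
  "bc_power \<sigma>2 r1 r2 = 2 powr (2 * (r1 + r2)) + (\<sigma>2 - 1) * 2 powr (2 * r2) - \<sigma>2"

lemma bc_power_split:
  assumes "0 \<le> p1" "p1 \<le> P" "0 < \<sigma>2"
  shows "bc_power \<sigma>2 (awgn_rate p1) (user2_rate \<sigma>2 P p1) = P"
proof -
  define q where "q = (P - p1) / (p1 + \<sigma>2)"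
  have q: "0 \<le> q" using assms by (simp add: q_def)
  have rate: "2 powr (2 * awgn_rate x) = 1 + x" if "0 \<le> x" for x
    using that by (simp add: awgn_rate_def)
  have "bc_power \<sigma>2 (awgn_rate p1) (awgn_rate q) = (1 + p1) * (1 + q) + (\<sigma>2 - 1) * (1 + q) - \<sigma>2"
    by (simp only: bc_power_def distrib_left[of 2] powr_add rate[OF assms(1)] rate[OF q])
  also have "\<dots> = (p1 + \<sigma>2) * (1 + q) - \<sigma>2" by (simp add: algebra_simps)
  also have "\<dots> = P" using assms by (simp add: q_def field_simps)
  finally show ?thesis by (simp add: user2_rate_def q_def)
qed


subsection \<open>Policies, energy causality and completion times\<close>

definition harvested :: "(nat \<Rightarrow> real) \<Rightarrow> (nat \<Rightarrow> real) \<Rightarrow> real \<Rightarrow> real" where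
  "harvested s E t = (\<Sum>i | s i < t. E i)"

definition consumed ::
  "real \<Rightarrow> (nat \<Rightarrow> real) \<Rightarrow> (nat \<Rightarrow> real) \<Rightarrow> (nat \<Rightarrow> real) \<Rightarrow> real \<Rightarrow> real" where
  "consumed \<sigma>2 s r1 r2 t =
     (\<Sum>k | s k < t. bc_power \<sigma>2 (r1 k) (r2 k) * (min (s (Suc k)) t - s k))"

definition delivered :: "(nat \<Rightarrow> real) \<Rightarrow> (nat \<Rightarrow> real) \<Rightarrow> real \<Rightarrow> real" where
  "delivered s r T = (\<Sum>k | s k < T. r k * (min (s (Suc k)) T - s k))"

definition energy_causal ::
  "real \<Rightarrow> (nat \<Rightarrow> real) \<Rightarrow> (nat \<Rightarrow> real) \<Rightarrow> real \<Rightarrow> (nat \<Rightarrow> real) \<Rightarrow> (nat \<Rightarrow> real) \<Rightarrow> bool" where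
  "energy_causal \<sigma>2 s E T r1 r2 \<longleftrightarrow>
     (\<forall>k. s k < T \<longrightarrow> 0 \<le> r1 k \<and> 0 \<le> r2 k) \<and>
     (\<forall>t\<in>{0..T}. consumed \<sigma>2 s r1 r2 t \<le> harvested s E t)"

definition completes ::
  "real \<Rightarrow> (nat \<Rightarrow> real) \<Rightarrow> (nat \<Rightarrow> real) \<Rightarrow> real \<Rightarrow> real \<Rightarrow> real
     \<Rightarrow> (nat \<Rightarrow> real) \<Rightarrow> (nat \<Rightarrow> real) \<Rightarrow> bool" where
  "completes \<sigma>2 s E B1 B2 T r1 r2 \<longleftrightarrow>
     0 \<le> T \<and> energy_causal \<sigma>2 s E T r1 r2 \<and> delivered s r1 T = B1 \<and> delivered s r2 T = B2"

definition is_min_completion_time ::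
  "real \<Rightarrow> (nat \<Rightarrow> real) \<Rightarrow> (nat \<Rightarrow> real) \<Rightarrow> real \<Rightarrow> real \<Rightarrow> real \<Rightarrow> bool" where
  "is_min_completion_time \<sigma>2 s E B1 B2 T \<longleftrightarrow>
     (\<exists>r1 r2. completes \<sigma>2 s E B1 B2 T r1 r2) \<and>
     (\<forall>T' r1 r2. completes \<sigma>2 s E B1 B2 T' r1 r2 \<longrightarrow> T \<le> T')"


subsection \<open>Total power for a fixed deadline\<close>

definition num_epochs :: "(nat \<Rightarrow> real) \<Rightarrow> real \<Rightarrow> nat" where
  "num_epochs s T = card {k. 0 < s k \<and> s k < T} + 1"

text \<open>The arrival times, with \<open>s\<^sub>N\<close> replaced by the deadline \<open>T\<close>.\<close>
definition knot :: "(nat \<Rightarrow> real) \<Rightarrow> real \<Rightarrow> nat \<Rightarrow> real" where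
  "knot s T = s(num_epochs s T := T)"

definition avg_power :: "(nat \<Rightarrow> real) \<Rightarrow> (nat \<Rightarrow> real) \<Rightarrow> nat \<Rightarrow> nat \<Rightarrow> real" where
  "avg_power s E m i = (\<Sum>j\<in>{m..<i}. E j) / (s i - s m)"

text \<open>The indices \<open>i\<^sub>n\<close>. The sequence stays at \<open>N\<close> once it has reached \<open>N\<close>.\<close>
primrec brk :: "(nat \<Rightarrow> real) \<Rightarrow> (nat \<Rightarrow> real) \<Rightarrow> real \<Rightarrow> nat \<Rightarrow> nat" where
  "brk s E T 0 = 0"
| "brk s E T (Suc n) =
     (if brk s E T n < num_epochs s T
      then arg_min_on (avg_power (knot s T) E (brk s E T n)) {brk s E T n <.. num_epochs s T}
      else num_epochs s T)"

text \<open>Segments are numbered from 0: segment \<open>n\<close> is \<open>[knot s T (brk s E T n), knot s T (brk s E T (n + 1)))\<close>.\<close>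
definition seg_power :: "(nat \<Rightarrow> real) \<Rightarrow> (nat \<Rightarrow> real) \<Rightarrow> real \<Rightarrow> nat \<Rightarrow> real" where
  "seg_power s E T n = avg_power (knot s T) E (brk s E T n) (brk s E T (Suc n))"

text \<open>The total power during epoch \<open>k\<close>; meaningful for \<open>s k < T\<close>.\<close>
definition total_power :: "(nat \<Rightarrow> real) \<Rightarrow> (nat \<Rightarrow> real) \<Rightarrow> real \<Rightarrow> nat \<Rightarrow> real" where
  "total_power s E T k = seg_power s E T (THE n. brk s E T n \<le> k \<and> k < brk s E T (Suc n))"

definition bits2 ::
  "real \<Rightarrow> (nat \<Rightarrow> real) \<Rightarrow> (nat \<Rightarrow> real) \<Rightarrow> real \<Rightarrow> real \<Rightarrow> real" where
  "bits2 \<sigma>2 s E T Pc =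
     (\<Sum>n | brk s E T n < num_epochs s T.
        user2_rate \<sigma>2 (seg_power s E T n) Pc *
        (knot s T (brk s E T (Suc n)) - knot s T (brk s E T n)))"


subsection \<open>The algorithm\<close>

definition const_energy :: "real \<Rightarrow> real \<Rightarrow> real \<Rightarrow> real \<Rightarrow> real" where
  "const_energy \<sigma>2 B1 B2 T = bc_power \<sigma>2 (B1 / T) (B2 / T) * T"

text \<open>\<open>i\<close> is the first index at which the energy needed for constant rates is smaller than the
  energy harvested, and \<open>T\<close> is the time at which constant rates use up exactly that energy.\<close>
definition step1 ::
  "real \<Rightarrow> (nat \<Rightarrow> real) \<Rightarrow> (nat \<Rightarrow> real) \<Rightarrow> real \<Rightarrow> real \<Rightarrow> nat \<Rightarrow> real \<Rightarrow> bool" where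
  "step1 \<sigma>2 s E B1 B2 i T \<longleftrightarrow>
     1 \<le> i \<and> const_energy \<sigma>2 B1 B2 (s i) < (\<Sum>j<i. E j) \<and>
     (\<forall>i'. 1 \<le> i' \<and> i' < i \<longrightarrow> \<not> const_energy \<sigma>2 B1 B2 (s i') < (\<Sum>j<i'. E j)) \<and>
     0 < T \<and> const_energy \<sigma>2 B1 B2 T = (\<Sum>j<i. E j)"

definition const_power_feasible ::
  "(nat \<Rightarrow> real) \<Rightarrow> (nat \<Rightarrow> real) \<Rightarrow> real \<Rightarrow> real \<Rightarrow> bool" where
  "const_power_feasible s E T P \<longleftrightarrow> (\<forall>t\<in>{0..T}. P * t \<le> harvested s E t)"

text \<open>
  The candidates for the corner of smallest slope are the arrivals \<open>1, \<dots>, i - 1\<close> whose energy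
  enters the computation of the tentative time \<open>T\<close> of \<open>step1\<close>. They are exactly the
  arrivals before \<open>T\<close> if \<open>s (i - 1) < T\<close>. If \<open>T \<le> s (i - 1)\<close>, the corner
  at \<open>s (i - 1)\<close> still has to be included: no policy can finish before \<open>s (i - 1)\<close>, so it is a
  binding constraint, and restricting to \<open>s j < T\<close> could even leave no candidate at all.
\<close>
definition step2 :: "(nat \<Rightarrow> real) \<Rightarrow> (nat \<Rightarrow> real) \<Rightarrow> nat \<Rightarrow> nat \<Rightarrow> bool" where
  "step2 s E i i1 \<longleftrightarrow> is_arg_min (avg_power s E 0) (\<lambda>j. 1 \<le> j \<and> j < i) i1"

text \<open>Step 3 is reached, with \<open>i1\<close> the index chosen in Step 2.\<close>
definition reaches_step3 ::
  "real \<Rightarrow> (nat \<Rightarrow> real) \<Rightarrow> (nat \<Rightarrow> real) \<Rightarrow> real \<Rightarrow> real \<Rightarrow> nat \<Rightarrow> bool" where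
  "reaches_step3 \<sigma>2 s E B1 B2 i1 \<longleftrightarrow>
     (\<exists>i T. step1 \<sigma>2 s E B1 B2 i T \<and>
            \<not> const_power_feasible s E T (1 / T * (\<Sum>j<i. E j)) \<and>
            step2 s E i i1)"

text \<open>
  \<open>allocates \<sigma>2 s E B1 B2 out T r1 r2\<close>: in the course of its run on the given problem, the algorithm
  makes the allocation \<open>r1\<close>, \<open>r2\<close> on \<open>[0, T)\<close>; the flag \<open>out\<close> tells whether this is its output, with
  completion time \<open>T\<close>. The tentative allocation of Step 3 is the output precisely when it gives
  user 2 exactly \<open>B2\<close> bits. The last rule is the recursion: time and arrivals are shifted so that
  the arrival \<open>i1\<close> becomes arrival 0, and the allocations found there are preceded by the
  allocation already fixed on \<open>[0, s i1)\<close>.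
\<close>
inductive allocates ::
  "real \<Rightarrow> (nat \<Rightarrow> real) \<Rightarrow> (nat \<Rightarrow> real) \<Rightarrow> real \<Rightarrow> real
     \<Rightarrow> bool \<Rightarrow> real \<Rightarrow> (nat \<Rightarrow> real) \<Rightarrow> (nat \<Rightarrow> real) \<Rightarrow> bool"
  for \<sigma>2 :: real
where
  constant_rates:
    "\<lbrakk> step1 \<sigma>2 s E B1 B2 i T;
       const_power_feasible s E T (1 / T * (\<Sum>j<i. E j)) \<rbrakk>
     \<Longrightarrow> allocates \<sigma>2 s E B1 B2 True T (\<lambda>_. B1 / T) (\<lambda>_. B2 / T)"
| tentative:
    "\<lbrakk> reaches_step3 \<sigma>2 s E B1 B2 i1; P1 = avg_power s E 0 i1; T1 = B1 / awgn_rate P1 \<rbrakk>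
     \<Longrightarrow> allocates \<sigma>2 s E B1 B2 (bits2 \<sigma>2 s E T1 P1 = B2) T1
           (\<lambda>_. awgn_rate P1) (\<lambda>k. user2_rate \<sigma>2 (total_power s E T1 k) P1)"
| step3a:
    "\<lbrakk> reaches_step3 \<sigma>2 s E B1 B2 i1; P1 = avg_power s E 0 i1; T1 = B1 / awgn_rate P1;
       bits2 \<sigma>2 s E T1 P1 < B2;
       0 < Pc; Pc < P1; T = B1 / awgn_rate Pc; B2 = bits2 \<sigma>2 s E T Pc \<rbrakk>
     \<Longrightarrow> allocates \<sigma>2 s E B1 B2 True T
           (\<lambda>_. awgn_rate Pc) (\<lambda>k. user2_rate \<sigma>2 (total_power s E T k) Pc)"
| step3b_first:
    "\<lbrakk> reaches_step3 \<sigma>2 s E B1 B2 i1; P1 = avg_power s E 0 i1; T1 = B1 / awgn_rate P1;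
       B2 < bits2 \<sigma>2 s E T1 P1 \<rbrakk>
     \<Longrightarrow> allocates \<sigma>2 s E B1 B2 False (s i1) (\<lambda>_. awgn_rate P1) (\<lambda>_. 0)"
| step3b_rest:
    "\<lbrakk> reaches_step3 \<sigma>2 s E B1 B2 i1; P1 = avg_power s E 0 i1; T1 = B1 / awgn_rate P1;
       B2 < bits2 \<sigma>2 s E T1 P1;
       allocates \<sigma>2 (\<lambda>k. s (i1 + k) - s i1) (\<lambda>k. E (i1 + k)) (B1 - awgn_rate P1 * s i1) B2
         out T' r1 r2 \<rbrakk>
     \<Longrightarrow> allocates \<sigma>2 s E B1 B2 out (s i1 + T')
           (\<lambda>k. if k < i1 then awgn_rate P1 else r1 (k - i1))
           (\<lambda>k. if k < i1 then 0 else r2 (k - i1))"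

end

theory Submission
  imports Defs
begin

text \<open>
  Optimality is a Lagrangian argument. Give epoch \<open>k\<close> an energy price \<open>\<mu> k\<close> that is
  nonincreasing in \<open>k\<close> and changes only at arrivals where all harvested energy has been used.
  Then, by Abel summation, no energy-causal policy spends more priced energy than the candidate.
  If moreover the power function, priced by \<open>\<mu>\<close>, has at the rates of the candidate a gradient
  proportional to \<open>(w, 1)\<close>, the same in every epoch (with an inequality for user 2 where it
  is silent), convexity shows that any policy delivering the same bits needs at least as long.
  A policy that gives user 1 the minimum of the total power and a constant cut-off power, the total
  power being the taut string under the harvested-energy curve, admits such prices.

  In the recursion, the tail of the tentative policy solves the continuation problem by \<open>T1\<close> with
  bits to spare. Optimality of the output for the continuation then bounds its cut-off power below
  by \<open>P1\<close>, so the prices extend over the prefix.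

  The cut-off power of Step 3a exists by the intermediate value theorem: as a function of the deadline,
  the bits of user 2 differ from the maximum of a concave functional over all energy-causal
  power schedules by an elementary term, and this maximum is continuous in the deadline.
\<close>

section \<open>Convexity of the power function\<close>

text \<open>At total power \<open>P\<close> with power \<open>p\<close> for user 1, the gradient of
  the power function in the two rates is \<open>2 * ln 2\<close> times a pair with second entry
  \<open>P + \<sigma>2\<close> and ratio \<open>(1 + p) / (p + \<sigma>2)\<close> of first to
  second. The ratio involves only \<open>p\<close>, which is why the cut-off is constant; the second
  entry dictates the price \<open>1 / (P + \<sigma>2)\<close>, which drops exactly where the taut
  string steepens. A competitor with an earlier deadline is treated as idling for the missing time.
  Zero rates cost no power, so convexity still applies, and idling is strictly wasteful. Two points
  are not visible in the rules of the algorithm. The cut-off must not exceed the total power in any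
  epoch: this uses the corner slopes before the index of Step 1 and the energy equation of Step 1
  from there on. And a short epoch of the taut string can carry arbitrarily large power, so
  continuity in the deadline cannot rest on a bound for the powers; it rests on the total
  energy.\<close>

lemma powr_2_tangent:
  fixes x y :: real
  shows "2 powr (2 * y) + 2 * ln 2 * 2 powr (2 * y) * (x - y) \<le> 2 powr (2 * x)"
    and "x \<noteq> y \<Longrightarrow> 2 powr (2 * y) + 2 * ln 2 * 2 powr (2 * y) * (x - y) < 2 powr (2 * x)"
proof -
  have eq: "2 powr (2 * x) = 2 powr (2 * y) * exp (2 * ln 2 * (x - y))"
    by (simp add: powr_def flip: exp_add) (simp add: algebra_simps)
  have "2 powr (2 * y) * (1 + 2 * ln 2 * (x - y)) \<le> 2 powr (2 * x)"
    unfolding eq by (intro mult_left_mono exp_ge_add_one_self) auto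
  then show "2 powr (2 * y) + 2 * ln 2 * 2 powr (2 * y) * (x - y) \<le> 2 powr (2 * x)"
    by (simp add: algebra_simps)
  assume "x \<noteq> y"
  then have "2 * ln 2 * (x - y) \<noteq> 0" by simp
  then have "1 + 2 * ln 2 * (x - y) < exp (2 * ln 2 * (x - y))"
    using exp_ge_add_one_self[of "2 * ln 2 * (x - y)"] exp_minus_greater[of "- (2 * ln 2 * (x - y))"]
    by (metis add.commute diff_minus_eq_add minus_minus neg_equal_0_iff_equal)
  then have "2 powr (2 * y) * (1 + 2 * ln 2 * (x - y)) < 2 powr (2 * x)"
    unfolding eq by (intro mult_strict_left_mono) auto
  then show "2 powr (2 * y) + 2 * ln 2 * 2 powr (2 * y) * (x - y) < 2 powr (2 * x)"
    by (simp add: algebra_simps)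
qed

lemma awgn_rate_powr: "-1 < p \<Longrightarrow> 2 powr (2 * awgn_rate p) = 1 + p"
  by (simp add: awgn_rate_def)

lemma awgn_rate_eqI: "2 powr (2 * r) = 1 + p \<Longrightarrow> awgn_rate p = r"
proof -
  assume "2 powr (2 * r) = 1 + p"
  then have "log 2 (1 + p) = 2 * r" by (simp flip: \<open>2 powr (2 * r) = 1 + p\<close>)
  then show ?thesis by (simp add: awgn_rate_def)
qed

lemma awgn_rate_0 [simp]: "awgn_rate 0 = 0"
  by (simp add: awgn_rate_def)

lemma awgn_rate_le_iff: "-1 < p \<Longrightarrow> -1 < q \<Longrightarrow> awgn_rate p \<le> awgn_rate q \<longleftrightarrow> p \<le> q"
  by (simp add: awgn_rate_def)

lemma awgn_rate_pos: "0 < p \<Longrightarrow> 0 < awgn_rate p"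
  by (simp add: awgn_rate_def)

lemma awgn_rate_nonneg: "0 \<le> p \<Longrightarrow> 0 \<le> awgn_rate p"
  by (simp add: awgn_rate_def)

lemma user2_rate_nonneg: "0 \<le> p \<Longrightarrow> p \<le> P \<Longrightarrow> 0 < \<sigma>2 \<Longrightarrow> 0 \<le> user2_rate \<sigma>2 P p"
  by (simp add: user2_rate_def awgn_rate_nonneg)

lemma user2_rate_powr:
  assumes "0 \<le> p" "0 \<le> P" "0 < \<sigma>2"
  shows "2 powr (2 * user2_rate \<sigma>2 P p) = (P + \<sigma>2) / (p + \<sigma>2)"
proof -
  have *: "1 + (P - p) / (p + \<sigma>2) = (P + \<sigma>2) / (p + \<sigma>2)"
    using assms by (simp add: field_simps)
  have "0 < (P + \<sigma>2) / (p + \<sigma>2)" using assms by simp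
  then have "-1 < (P - p) / (p + \<sigma>2)" using * by linarith
  then show ?thesis unfolding user2_rate_def by (simp add: awgn_rate_powr *)
qed

lemma user2_rate_diff:
  assumes "0 \<le> p" "0 \<le> P" "0 < \<sigma>2"
  shows "user2_rate \<sigma>2 P p = 1 / 2 * log 2 (P + \<sigma>2) - 1 / 2 * log 2 (p + \<sigma>2)"
proof -
  have *: "1 + (P - p) / (p + \<sigma>2) = (P + \<sigma>2) / (p + \<sigma>2)"
    using assms by (simp add: field_simps)
  show ?thesis
    unfolding user2_rate_def awgn_rate_def * using assms by (simp add: log_divide field_simps)
qed

lemma bc_power_mono:
  assumes "1 \<le> \<sigma>2" "a \<le> c" "b \<le> d"
  shows "bc_power \<sigma>2 a b \<le> bc_power \<sigma>2 c d"
  unfolding bc_power_def using assms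
  by (intro diff_mono add_mono mult_left_mono powr_mono) auto

lemma bc_power_strict_mono2:
  assumes "1 \<le> \<sigma>2" "b < d"
  shows "bc_power \<sigma>2 a b < bc_power \<sigma>2 a d"
  unfolding bc_power_def using assms
  by (intro diff_strict_right_mono add_less_le_mono mult_left_mono powr_mono powr_less_mono) auto

lemma bc_power_0 [simp]: "bc_power \<sigma>2 0 0 = 0"
  by (simp add: bc_power_def)

lemma bc_power_nonneg: "1 \<le> \<sigma>2 \<Longrightarrow> 0 \<le> a \<Longrightarrow> 0 \<le> b \<Longrightarrow> 0 \<le> bc_power \<sigma>2 a b"
  using bc_power_mono[of \<sigma>2 0 a 0 b] by simp

lemma bc_power_user1: "-1 < p \<Longrightarrow> bc_power \<sigma>2 (awgn_rate p) 0 = p"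
  by (simp add: bc_power_def awgn_rate_powr)

text \<open>The power is an exponential in the sum rate plus one in \<open>r2\<close>; up to
  \<open>2 * ln 2\<close>, its partial derivatives at \<open>(q1, q2)\<close> are \<open>X\<close>
  and \<open>X + Z\<close>. Strictness is drawn from the first exponential alone, since the factor
  \<open>\<sigma>2 - 1\<close> of the second may vanish under the assumption made.\<close>

lemma bc_power_tangent:
  fixes \<sigma>2 q1 q2 r1 r2 :: real
  assumes "1 \<le> \<sigma>2"
  defines "X \<equiv> 2 powr (2 * (q1 + q2))" and "Z \<equiv> (\<sigma>2 - 1) * 2 powr (2 * q2)"
  shows "2 * ln 2 * (X * (r1 - q1) + (X + Z) * (r2 - q2)) \<le> bc_power \<sigma>2 r1 r2 - bc_power \<sigma>2 q1 q2"
    and "r1 + r2 \<noteq> q1 + q2 \<Longrightarrow>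
      2 * ln 2 * (X * (r1 - q1) + (X + Z) * (r2 - q2)) < bc_power \<sigma>2 r1 r2 - bc_power \<sigma>2 q1 q2"
proof -
  note t1 = powr_2_tangent[where y = "q1 + q2" and x = "r1 + r2", folded X_def]
  have "(\<sigma>2 - 1) * (2 powr (2 * q2) + 2 * ln 2 * 2 powr (2 * q2) * (r2 - q2)) \<le> (\<sigma>2 - 1) * 2 powr (2 * r2)"
    using assms(1) by (intro mult_left_mono powr_2_tangent) auto
  then have t2: "Z + 2 * ln 2 * Z * (r2 - q2) \<le> (\<sigma>2 - 1) * 2 powr (2 * r2)"
    unfolding Z_def by (simp add: algebra_simps)
  have split: "2 * ln 2 * (X * (r1 - q1) + (X + Z) * (r2 - q2)) =
     2 * ln 2 * X * (r1 + r2 - (q1 + q2)) + 2 * ln 2 * Z * (r2 - q2)"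
    by (simp add: algebra_simps)
  have gq: "bc_power \<sigma>2 q1 q2 = X + Z - \<sigma>2" by (simp add: bc_power_def X_def Z_def)
  show "2 * ln 2 * (X * (r1 - q1) + (X + Z) * (r2 - q2)) \<le> bc_power \<sigma>2 r1 r2 - bc_power \<sigma>2 q1 q2"
    unfolding split gq unfolding bc_power_def using t1(1) t2 by linarith
  assume "r1 + r2 \<noteq> q1 + q2"
  from t1(2)[OF this] t2
  show "2 * ln 2 * (X * (r1 - q1) + (X + Z) * (r2 - q2)) < bc_power \<sigma>2 r1 r2 - bc_power \<sigma>2 q1 q2"
    unfolding split gq unfolding bc_power_def by linarith
qed

text \<open>Running at rates \<open>r\<close> for time \<open>l'\<close> and idling for time \<open>l - l'\<close>, compared with rates \<open>q\<close> for time \<open>l\<close>.\<close>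
lemma bc_power_tangent_time:
  fixes \<sigma>2 q1 q2 r1 r2 l l' :: real
  assumes "1 \<le> \<sigma>2" "0 \<le> l'" "l' \<le> l"
  defines "X \<equiv> 2 powr (2 * (q1 + q2))" and "Z \<equiv> (\<sigma>2 - 1) * 2 powr (2 * q2)"
  shows "2 * ln 2 * (X * (r1 * l' - q1 * l) + (X + Z) * (r2 * l' - q2 * l))
           \<le> bc_power \<sigma>2 r1 r2 * l' - bc_power \<sigma>2 q1 q2 * l"
    and "l' < l \<Longrightarrow> 0 < q1 + q2 \<Longrightarrow> 2 * ln 2 * (X * (r1 * l' - q1 * l) + (X + Z) * (r2 * l' - q2 * l))
           < bc_power \<sigma>2 r1 r2 * l' - bc_power \<sigma>2 q1 q2 * l"
proof -
  note T = bc_power_tangent[OF assms(1), where ?q1.0 = q1 and ?q2.0 = q2, folded X_def Z_def]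
  have a: "2 * ln 2 * (X * (r1 - q1) + (X + Z) * (r2 - q2)) * l' \<le> (bc_power \<sigma>2 r1 r2 - bc_power \<sigma>2 q1 q2) * l'"
    using T(1) assms by (intro mult_right_mono) auto
  \<comment> \<open>Idling is the same tangent inequality at zero rates, where the power is 0; the
    two inequalities are weighted with the running time \<open>l'\<close> and the idle time
    \<open>l - l'\<close>.\<close>
  have b: "2 * ln 2 * (X * (0 - q1) + (X + Z) * (0 - q2)) * (l - l') \<le> (bc_power \<sigma>2 0 0 - bc_power \<sigma>2 q1 q2) * (l - l')"
    using T(1)[where ?r1.0 = 0 and ?r2.0 = 0] assms by (intro mult_right_mono) auto
  have eq: "2 * ln 2 * (X * (r1 * l' - q1 * l) + (X + Z) * (r2 * l' - q2 * l)) =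
     2 * ln 2 * (X * (r1 - q1) + (X + Z) * (r2 - q2)) * l' +
     2 * ln 2 * (X * (0 - q1) + (X + Z) * (0 - q2)) * (l - l')"
    by (simp add: algebra_simps)
  have eq2: "bc_power \<sigma>2 r1 r2 * l' - bc_power \<sigma>2 q1 q2 * l =
     (bc_power \<sigma>2 r1 r2 - bc_power \<sigma>2 q1 q2) * l' + (bc_power \<sigma>2 0 0 - bc_power \<sigma>2 q1 q2) * (l - l')"
    by (simp add: algebra_simps)
  show "2 * ln 2 * (X * (r1 * l' - q1 * l) + (X + Z) * (r2 * l' - q2 * l))
           \<le> bc_power \<sigma>2 r1 r2 * l' - bc_power \<sigma>2 q1 q2 * l"
    unfolding eq eq2 using a b by linarith
  assume "l' < l" "0 < q1 + q2"
  then have "2 * ln 2 * (X * (0 - q1) + (X + Z) * (0 - q2)) * (l - l') < (bc_power \<sigma>2 0 0 - bc_power \<sigma>2 q1 q2) * (l - l')"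
    using T(2)[where ?r1.0 = 0 and ?r2.0 = 0] by (intro mult_strict_right_mono) auto
  then show "2 * ln 2 * (X * (r1 * l' - q1 * l) + (X + Z) * (r2 * l' - q2 * l))
           < bc_power \<sigma>2 r1 r2 * l' - bc_power \<sigma>2 q1 q2 * l"
    unfolding eq eq2 using a by linarith
qed

text \<open>Running at the faster rates until \<open>T'\<close> and then idling until
  \<open>T\<close> delivers the bits of the slower rates. The linear side of the tangent inequality
  therefore vanishes, and the idle time makes it strict.\<close>

lemma const_energy_strict_antimono:
  assumes "1 \<le> \<sigma>2" "0 < B1" "0 \<le> B2" "0 < T'" "T' < T"
  shows "const_energy \<sigma>2 B1 B2 T < const_energy \<sigma>2 B1 B2 T'"
  using bc_power_tangent_time(2)[OF assms(1), of T' T "B1 / T" "B2 / T" "B1 / T'" "B2 / T'"] assms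
  by (simp add: const_energy_def add_pos_nonneg)

lemma const_energy_antimono:
  assumes "1 \<le> \<sigma>2" "0 < B1" "0 \<le> B2" "0 < T'" "T' \<le> T"
  shows "const_energy \<sigma>2 B1 B2 T \<le> const_energy \<sigma>2 B1 B2 T'"
  using const_energy_strict_antimono[OF assms(1-4), of T] assms(5) by (cases "T' = T") auto

lemma const_energy_less_iff:
  assumes "1 \<le> \<sigma>2" "0 < B1" "0 \<le> B2" "0 < T'" "0 < T"
  shows "const_energy \<sigma>2 B1 B2 T < const_energy \<sigma>2 B1 B2 T' \<longleftrightarrow> T' < T"
  using const_energy_strict_antimono[OF assms(1-4), of T] const_energy_antimono[OF assms(1-3,5), of T']
  by (meson linorder_not_le)

lemma const_energy_strict_mono2:
  assumes "1 \<le> \<sigma>2" "B2 < D" "0 < T"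
  shows "const_energy \<sigma>2 B1 B2 T < const_energy \<sigma>2 B1 D T"
  unfolding const_energy_def using assms
  by (intro mult_strict_right_mono bc_power_strict_mono2 divide_strict_right_mono) auto

lemma const_energy_ge_user1:
  assumes "1 \<le> \<sigma>2" "0 < T" "0 \<le> B2" "0 \<le> p" "B1 = awgn_rate p * T"
  shows "p * T \<le> const_energy \<sigma>2 B1 B2 T"
proof -
  have "p = bc_power \<sigma>2 (awgn_rate p) 0" using assms by (simp add: bc_power_user1)
  also have "\<dots> \<le> bc_power \<sigma>2 (B1 / T) (B2 / T)" using assms by (intro bc_power_mono) auto
  finally show ?thesis unfolding const_energy_def using assms by (intro mult_right_mono) auto
qed

text \<open>The quadratic Taylor bound for \<open>exp\<close> outweighs the factor \<open>T\<close>,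
  so the energy is unbounded as the deadline tends to 0. This supplies the left end point for
  solving the equation of Step 1.\<close>

lemma const_energy_ge_inverse:
  assumes "1 \<le> \<sigma>2" "0 < T" "0 \<le> B1" "0 \<le> B2"
  shows "2 * (ln 2 * B1)\<^sup>2 / T \<le> const_energy \<sigma>2 B1 B2 T"
proof -
  define x where "x = 2 * (B1 / T) * ln 2"
  have x: "0 \<le> x" using assms by (simp add: x_def)
  have "x\<^sup>2 / 2 \<le> exp x - 1"
    using exp_lower_Taylor_quadratic[OF x] x by linarith
  also have "exp x - 1 = bc_power \<sigma>2 (B1 / T) 0"
    by (simp add: bc_power_def x_def powr_def)
  also have "\<dots> \<le> bc_power \<sigma>2 (B1 / T) (B2 / T)"
    using assms by (intro bc_power_mono) auto
  finally have "x\<^sup>2 / 2 * T \<le> const_energy \<sigma>2 B1 B2 T"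
    unfolding const_energy_def using assms by (intro mult_right_mono) auto
  moreover have "x\<^sup>2 / 2 * T = 2 * (ln 2 * B1)\<^sup>2 / T"
    using assms by (simp add: x_def power2_eq_square field_simps)
  ultimately show ?thesis by simp
qed

lemma const_energy_solution:
  assumes "1 \<le> \<sigma>2" "0 < B1" "0 \<le> B2" "0 < S" "0 < H" "const_energy \<sigma>2 B1 B2 S < H"
  obtains T where "0 < T" "const_energy \<sigma>2 B1 B2 T = H"
proof -
  \<comment> \<open>Small enough for the inverse bound to reach \<open>H\<close>, and not beyond
    \<open>S\<close>, where the energy is already below \<open>H\<close>.\<close>
  define T0 where "T0 = min S (2 * (ln 2 * B1)\<^sup>2 / H)"
  have T0: "0 < T0" "T0 \<le> S" using assms by (auto simp: T0_def)
  have "T0 \<le> 2 * (ln 2 * B1)\<^sup>2 / H" by (simp add: T0_def)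
  then have "H \<le> 2 * (ln 2 * B1)\<^sup>2 / T0" using T0 assms by (simp add: field_simps)
  also have "\<dots> \<le> const_energy \<sigma>2 B1 B2 T0"
    using assms T0 by (intro const_energy_ge_inverse) auto
  finally have "H \<le> const_energy \<sigma>2 B1 B2 T0" .
  moreover have "continuous_on {T0..S} (const_energy \<sigma>2 B1 B2)"
    unfolding const_energy_def bc_power_def using T0 by (intro continuous_intros) auto
  ultimately obtain T where "T0 \<le> T" "T \<le> S" "const_energy \<sigma>2 B1 B2 T = H"
    using IVT2'[of "const_energy \<sigma>2 B1 B2" S H T0] assms T0 by auto
  with T0 show ?thesis by (intro that[of T]) auto
qed


section \<open>Discretisation of policies\<close>

text \<open>The invariant is that a weighted partial sum is at most the current weight times the
  unweighted one. Lowering the weight preserves it, because the partial sum is nonpositive wherever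
  the weight changes.\<close>

lemma sum_mult_nonpos_Abel:
  fixes \<mu> d :: "nat \<Rightarrow> real"
  assumes "\<And>k. k < N \<Longrightarrow> 0 \<le> \<mu> k"
    and "\<And>k. Suc k < N \<Longrightarrow> \<mu> (Suc k) \<le> \<mu> k"
    and "\<And>k. Suc k < N \<Longrightarrow> \<mu> (Suc k) \<noteq> \<mu> k \<Longrightarrow> (\<Sum>j<Suc k. d j) \<le> 0"
    and "(\<Sum>j<N. d j) \<le> 0"
  shows "(\<Sum>k<N. \<mu> k * d k) \<le> 0"
proof (cases N)
  case (Suc n)
  have "(\<Sum>k<Suc m. \<mu> k * d k) \<le> \<mu> m * (\<Sum>j<Suc m. d j)" if "m < N" for m
    using that
  proof (induction m)
    case (Suc m)
    have "(\<Sum>k<Suc m. \<mu> k * d k) \<le> \<mu> m * (\<Sum>j<Suc m. d j)" using Suc by simp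
    also have "\<dots> \<le> \<mu> (Suc m) * (\<Sum>j<Suc m. d j)"
      using assms(2,3)[of m] Suc.prems by (cases "\<mu> (Suc m) = \<mu> m") (auto intro: mult_right_mono_neg)
    finally show ?case by (simp add: algebra_simps)
  qed simp
  from this[of n] have "(\<Sum>k<N. \<mu> k * d k) \<le> \<mu> n * (\<Sum>j<N. d j)" using Suc by simp
  also have "\<dots> \<le> 0" using assms(1)[of n] assms(4) Suc by (simp add: mult_nonneg_nonpos)
  finally show ?thesis .
qed simp

text \<open>Cutting off at 0 gives length 0 to all epochs from the deadline on, so policies with
  different deadlines can be summed over a common index range.\<close>

definition epoch_len :: "(nat \<Rightarrow> real) \<Rightarrow> real \<Rightarrow> nat \<Rightarrow> real" where
  "epoch_len s T k = max 0 (min (s (Suc k)) T - s k)"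

definition cum_energy ::
  "real \<Rightarrow> (nat \<Rightarrow> real) \<Rightarrow> real \<Rightarrow> (nat \<Rightarrow> real) \<Rightarrow> (nat \<Rightarrow> real) \<Rightarrow> nat \<Rightarrow> real" where
  "cum_energy \<sigma>2 s T r1 r2 m = (\<Sum>k<m. bc_power \<sigma>2 (r1 k) (r2 k) * epoch_len s T k)"

lemma epoch_len_nonneg [simp]: "0 \<le> epoch_len s T k"
  by (simp add: epoch_len_def)

lemma epoch_len_mono: "T' \<le> T \<Longrightarrow> epoch_len s T' k \<le> epoch_len s T k"
  by (auto simp: epoch_len_def)

section \<open>Arrivals and their epochs\<close>

locale arrival_process =
  fixes s E :: "nat \<Rightarrow> real"
  assumes s_0: "s 0 = 0" and s_mono: "strict_mono s" and s_fin: "\<And>T. finite {k. s k < T}"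
    and E_0: "E 0 > 0" and E_nonneg: "\<And>k. E k \<ge> 0"
begin

lemma s_less_iff [simp]: "s i < s j \<longleftrightarrow> i < j"
  using s_mono by (simp add: strict_mono_less)

lemma s_le_iff [simp]: "s i \<le> s j \<longleftrightarrow> i \<le> j"
  using s_mono by (simp add: strict_mono_less_eq)

lemma s_pos: "0 < k \<Longrightarrow> 0 < s k"
  using s_less_iff[of 0 k] s_0 by simp

lemma s_nonneg: "0 \<le> s k"
  using s_le_iff[of 0 k] s_0 by simp

lemma E_cum_mono: "m \<le> n \<Longrightarrow> sum E {..<m} \<le> sum E {..<n}"
  using E_nonneg by (intro sum_mono2) auto

lemma E_cum_pos: "0 < m \<Longrightarrow> 0 < sum E {..<m}"
  using E_cum_mono[of 1 m] E_0 by simp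

text \<open>As \<open>s\<close> is increasing, the indices of arrivals before \<open>T\<close> form
  an initial segment, whose length is its cardinality; the added 1 in \<open>num_epochs\<close> is
  arrival 0.\<close>

lemma less_num_epochs_iff:
  assumes "0 < T"
  shows "k < num_epochs s T \<longleftrightarrow> s k < T"
proof -
  let ?A = "{k. s k < T}"
  have "?A = insert 0 {k. 0 < s k \<and> s k < T}"
    using assms s_0 s_nonneg s_pos by auto
  moreover have "finite {k. 0 < s k \<and> s k < T}"
    by (rule finite_subset[OF _ s_fin[of T]]) auto
  ultimately have card: "num_epochs s T = card ?A"
    using s_0 by (simp add: num_epochs_def)
  obtain m where m: "m \<notin> ?A" using s_fin[of T] ex_new_if_finite infinite_UNIV_nat by blast
  define n where "n = (LEAST m. m \<notin> ?A)"
  have "n \<notin> ?A" unfolding n_def by (rule LeastI[of "\<lambda>m. m \<notin> ?A", OF m])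
  then have *: "?A = {..<n}"
    using not_less_Least[of _ "\<lambda>m. m \<notin> ?A"] unfolding n_def
    by (metis (no_types, lifting) s_le_iff lessThan_iff linorder_not_le mem_Collect_eq order_less_le_trans
        set_eqI n_def order_trans)
  then show ?thesis unfolding card by (metis card_lessThan lessThan_iff mem_Collect_eq)
qed

lemma num_epochs_pos: "0 < num_epochs s T"
  by (simp add: num_epochs_def)

lemma arrivals_before: "0 < T \<Longrightarrow> {k. s k < T} = {..<num_epochs s T}"
  by (auto simp: less_num_epochs_iff)

lemma le_s_num_epochs: "0 < T \<Longrightarrow> T \<le> s (num_epochs s T)"
  using less_num_epochs_iff[of T "num_epochs s T"] by simp

lemma num_epochs_mono: "0 < T' \<Longrightarrow> T' \<le> T \<Longrightarrow> num_epochs s T' \<le> num_epochs s T"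
  by (meson less_num_epochs_iff linorder_not_le order_less_le_trans order_less_le nless_le)

lemma num_epochs_leI: "0 < T \<Longrightarrow> T \<le> s i \<Longrightarrow> num_epochs s T \<le> i"
  by (meson less_num_epochs_iff linorder_not_le)

lemma num_epochs_s: "0 < i \<Longrightarrow> num_epochs s (s i) = i"
  by (metis less_num_epochs_iff linorder_neq_iff s_less_iff s_pos)

lemma epoch_len_eq: "0 < T \<Longrightarrow> k < num_epochs s T \<Longrightarrow> epoch_len s T k = min (s (Suc k)) T - s k"
  by (simp add: epoch_len_def less_num_epochs_iff less_imp_le)

lemma epoch_len_pos: "0 < T \<Longrightarrow> k < num_epochs s T \<Longrightarrow> 0 < epoch_len s T k"
  by (simp add: epoch_len_def less_num_epochs_iff)

lemma epoch_len_0: "0 < T \<Longrightarrow> num_epochs s T \<le> k \<Longrightarrow> epoch_len s T k = 0"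
  using less_num_epochs_iff[of T k] by (simp add: epoch_len_def)

lemma sum_epoch_len_extend:
  "0 < T \<Longrightarrow> num_epochs s T \<le> M \<Longrightarrow>
    (\<Sum>k<num_epochs s T. f k * epoch_len s T k) = (\<Sum>k<M. f k * epoch_len s T k)"
  by (rule sum.mono_neutral_left) (auto simp: epoch_len_0)

lemma sum_epoch_len_initial: "0 < T \<Longrightarrow> m \<le> num_epochs s T \<Longrightarrow> (\<Sum>k<m. epoch_len s T k) = min (s m) T"
proof (induction m)
  case (Suc m)
  then have "s m < T" by (simp flip: less_num_epochs_iff)
  with Suc show ?case by (simp add: epoch_len_eq)
qed (simp add: s_0)

lemma sum_epoch_len: "0 < T \<Longrightarrow> (\<Sum>k<num_epochs s T. epoch_len s T k) = T"
  using le_s_num_epochs[of T] by (simp add: sum_epoch_len_initial)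

lemma delivered_eq: "0 < T \<Longrightarrow> delivered s r T = (\<Sum>k<num_epochs s T. r k * epoch_len s T k)"
  unfolding delivered_def arrivals_before by (intro sum.cong) (auto simp: epoch_len_eq)

lemma consumed_eq:
  "0 < T \<Longrightarrow> consumed \<sigma>2 s r1 r2 T = (\<Sum>k<num_epochs s T. bc_power \<sigma>2 (r1 k) (r2 k) * epoch_len s T k)"
  unfolding consumed_def arrivals_before by (intro sum.cong) (auto simp: epoch_len_eq)

lemma harvested_eq: "0 < T \<Longrightarrow> harvested s E T = sum E {..<num_epochs s T}"
  by (simp add: harvested_def arrivals_before)

lemma no_arrivals_before_0: "{k. s k < 0} = {}"
  using s_nonneg by (auto simp: not_less)

text \<open>Since harvested energy is a step function, causality need only be checked at the arrivals and at \<open>T\<close>.\<close>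
lemma energy_causal_iff:
  assumes "0 < T" "1 \<le> \<sigma>2"
  shows "energy_causal \<sigma>2 s E T r1 r2 \<longleftrightarrow>
    (\<forall>k<num_epochs s T. 0 \<le> r1 k \<and> 0 \<le> r2 k) \<and>
    (\<forall>m\<le>num_epochs s T. (\<Sum>k<m. bc_power \<sigma>2 (r1 k) (r2 k) * epoch_len s T k) \<le> sum E {..<m})"
    (is "?L \<longleftrightarrow> ?R1 \<and> ?R2")
proof
  assume L: ?L
  then have ?R1 by (auto simp: energy_causal_def less_num_epochs_iff assms)
  moreover have ?R2
  proof (intro allI impI)
    fix m assume m: "m \<le> num_epochs s T"
    show "(\<Sum>k<m. bc_power \<sigma>2 (r1 k) (r2 k) * epoch_len s T k) \<le> sum E {..<m}"
    proof (cases "m = 0")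
      case False
      \<comment> \<open>Arrivals at time \<open>t\<close> itself do not count as harvested before
        \<open>t\<close>, so at this time exactly the first \<open>m\<close> arrivals are available
        and the first \<open>m\<close> epochs are over, up to the cut at \<open>T\<close>.\<close>
      define t where "t = min (s m) T"
      have t: "0 < t" "t \<le> T" using False assms s_pos by (auto simp: t_def)
      have N: "num_epochs s t = m"
      proof (rule antisym)
        show "num_epochs s t \<le> m" using t by (intro num_epochs_leI) (auto simp: t_def)
        show "m \<le> num_epochs s t"
          by (metis (no_types, lifting) t_def less_num_epochs_iff linorder_not_le m assms(1) min_less_iff_conj
              nless_le order_less_le_trans s_less_iff t(1))
      qed
      have len: "epoch_len s t k = epoch_len s T k" if "k < m" for k
      proof -
        have "s (Suc k) \<le> s m" using that by simp
        then have "min (s (Suc k)) t = min (s (Suc k)) T" unfolding t_def by linarith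
        then show ?thesis by (simp add: epoch_len_def)
      qed
      have "consumed \<sigma>2 s r1 r2 t \<le> harvested s E t"
        using L t unfolding energy_causal_def by auto
      then show ?thesis using t by (simp add: consumed_eq harvested_eq N len)
    qed simp
  qed
  ultimately show "?R1 \<and> ?R2" ..
next
  assume R: "?R1 \<and> ?R2"
  show ?L unfolding energy_causal_def
  proof (intro conjI ballI)
    show "\<forall>k. s k < T \<longrightarrow> 0 \<le> r1 k \<and> 0 \<le> r2 k"
      using R by (auto simp: less_num_epochs_iff assms)
    fix t assume t: "t \<in> {0..T}"
    show "consumed \<sigma>2 s r1 r2 t \<le> harvested s E t"
    proof (cases "t = 0")
      case True
      then show ?thesis by (simp add: consumed_def harvested_def no_arrivals_before_0)
    next
      case False
      then have t: "0 < t" "t \<le> T" using t by auto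
      have N: "num_epochs s t \<le> num_epochs s T" using num_epochs_mono t by simp
      have "consumed \<sigma>2 s r1 r2 t = (\<Sum>k<num_epochs s t. bc_power \<sigma>2 (r1 k) (r2 k) * epoch_len s t k)"
        using t by (simp add: consumed_eq)
      \<comment> \<open>The epoch containing \<open>t\<close> is run to its end: this costs more
        energy, while the right-hand side of the constraint stays the same.\<close>
      also have "\<dots> \<le> (\<Sum>k<num_epochs s t. bc_power \<sigma>2 (r1 k) (r2 k) * epoch_len s T k)"
        using R N t assms by (intro sum_mono mult_left_mono epoch_len_mono bc_power_nonneg) auto
      also have "\<dots> \<le> sum E {..<num_epochs s t}" using R N by blast
      finally show ?thesis using t by (simp add: harvested_eq)
    qed
  qed
qed

lemma cum_le_extend:
  assumes T: "0 < T"
    and le: "\<And>m. m \<le> num_epochs s T \<Longrightarrow> (\<Sum>k<m. f k * epoch_len s T k) \<le> sum E {..<m}"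
  shows "(\<Sum>k<m. f k * epoch_len s T k) \<le> sum E {..<m}"
proof (cases "m \<le> num_epochs s T")
  case False
  then have "(\<Sum>k<m. f k * epoch_len s T k) = (\<Sum>k<num_epochs s T. f k * epoch_len s T k)"
    using sum_epoch_len_extend[OF T, of m] by simp
  also have "\<dots> \<le> sum E {..<num_epochs s T}" by (rule le[OF order_refl])
  also have "\<dots> \<le> sum E {..<m}" using False by (intro E_cum_mono) simp
  finally show ?thesis .
qed (rule le)

lemma energy_causal_cum:
  assumes "0 < T" "1 \<le> \<sigma>2" "energy_causal \<sigma>2 s E T r1 r2"
  shows "(\<Sum>k<m. bc_power \<sigma>2 (r1 k) (r2 k) * epoch_len s T k) \<le> sum E {..<m}"
proof (rule cum_le_extend[OF assms(1)])
  show "(\<Sum>k<m. bc_power \<sigma>2 (r1 k) (r2 k) * epoch_len s T k) \<le> sum E {..<m}" if "m \<le> num_epochs s T" for m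
    using that assms(3) unfolding energy_causal_iff[OF assms(1,2)] by blast
qed

lemma completes_pos:
  assumes "completes \<sigma>2 s E B1 B2 T r1 r2" "0 < B1"
  shows "0 < T"
proof (rule ccontr)
  assume "\<not> 0 < T"
  then have "T = 0" using assms by (simp add: completes_def)
  then show False using assms by (simp add: completes_def delivered_def no_arrivals_before_0)
qed

text \<open>Jensen's inequality: summing the tangent plane at the constant rates
  \<open>B1 / T\<close>, \<open>B2 / T\<close> over the epochs cancels the linear terms, so constant
  rates need the least total energy for the given bits and duration.\<close>

lemma completes_const_energy:
  assumes "1 \<le> \<sigma>2" "completes \<sigma>2 s E B1 B2 T r1 r2" "0 < B1"
  shows "const_energy \<sigma>2 B1 B2 T \<le> sum E {..<num_epochs s T}"
proof -
  let ?N = "num_epochs s T" and ?l = "epoch_len s T"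
  have T: "0 < T" using completes_pos assms by auto
  have B: "(\<Sum>k<?N. r1 k * ?l k) = B1" "(\<Sum>k<?N. r2 k * ?l k) = B2"
    using assms(2) T by (auto simp: completes_def delivered_eq)
  define X where "X = 2 powr (2 * (B1 / T + B2 / T))"
  define Z where "Z = (\<sigma>2 - 1) * 2 powr (2 * (B2 / T))"
  have "(\<Sum>k<?N. 2 * ln 2 * (X * (r1 k * ?l k - B1 / T * ?l k) + (X + Z) * (r2 k * ?l k - B2 / T * ?l k)))
    \<le> (\<Sum>k<?N. bc_power \<sigma>2 (r1 k) (r2 k) * ?l k - bc_power \<sigma>2 (B1 / T) (B2 / T) * ?l k)"
    unfolding X_def Z_def using assms(1) by (intro sum_mono bc_power_tangent_time) auto
  moreover have "(\<Sum>k<?N. 2 * ln 2 * (X * (r1 k * ?l k - B1 / T * ?l k) + (X + Z) * (r2 k * ?l k - B2 / T * ?l k)))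
     = 2 * ln 2 * (X * (B1 - B1 / T * T) + (X + Z) * (B2 - B2 / T * T))"
    unfolding sum_distrib_left[symmetric] sum.distrib sum_subtractf
    using T by (simp add: B sum_epoch_len)
  moreover have "(\<Sum>k<?N. bc_power \<sigma>2 (r1 k) (r2 k) * ?l k - bc_power \<sigma>2 (B1 / T) (B2 / T) * ?l k)
     = (\<Sum>k<?N. bc_power \<sigma>2 (r1 k) (r2 k) * ?l k) - const_energy \<sigma>2 B1 B2 T"
    unfolding sum_subtractf sum_distrib_left[symmetric] const_energy_def using T by (simp add: sum_epoch_len)
  moreover have "(\<Sum>k<?N. bc_power \<sigma>2 (r1 k) (r2 k) * ?l k) \<le> sum E {..<?N}"
    using energy_causal_cum[OF T assms(1)] assms(2) by (auto simp: completes_def)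
  ultimately show ?thesis using T by simp
qed

lemma completes_fewer_bits:
  assumes "1 \<le> \<sigma>2" "completes \<sigma>2 s E B1 D T r1 r2" "0 < T" "0 \<le> B2" "B2 \<le> D"
  shows "completes \<sigma>2 s E B1 B2 T r1 (\<lambda>k. B2 / D * r2 k)"
proof -
  \<comment> \<open>If \<open>D\<close> is 0, then so is \<open>B2\<close>, and the quotient is 0 as
    well.\<close>
  have c: "0 \<le> B2 / D" "B2 / D \<le> 1" using assms by (auto simp: divide_le_eq)
  have causal: "energy_causal \<sigma>2 s E T r1 r2" using assms by (simp add: completes_def)
  then have nn: "0 \<le> r1 k \<and> 0 \<le> r2 k" if "k < num_epochs s T" for k
    using that assms energy_causal_iff by blast
  have "energy_causal \<sigma>2 s E T r1 (\<lambda>k. B2 / D * r2 k)"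
    unfolding energy_causal_iff[OF assms(3,1)]
  proof (intro conjI allI impI)
    fix k assume "k < num_epochs s T"
    then show "0 \<le> r1 k" "0 \<le> B2 / D * r2 k" using nn c(1) mult_nonneg_nonneg by blast+
  next
    fix m assume m: "m \<le> num_epochs s T"
    have "bc_power \<sigma>2 (r1 k) (B2 / D * r2 k) * epoch_len s T k \<le> bc_power \<sigma>2 (r1 k) (r2 k) * epoch_len s T k"
      if "k < m" for k
      using mult_right_mono[OF c(2), of "r2 k"] nn[of k] that m assms
      by (intro mult_right_mono bc_power_mono) auto
    then have "(\<Sum>k<m. bc_power \<sigma>2 (r1 k) (B2 / D * r2 k) * epoch_len s T k)
      \<le> (\<Sum>k<m. bc_power \<sigma>2 (r1 k) (r2 k) * epoch_len s T k)"
      by (intro sum_mono) auto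
    also have "\<dots> \<le> sum E {..<m}" using energy_causal_cum[OF assms(3,1) causal] .
    finally show "(\<Sum>k<m. bc_power \<sigma>2 (r1 k) (B2 / D * r2 k) * epoch_len s T k) \<le> sum E {..<m}" .
  qed
  moreover have "delivered s (\<lambda>k. B2 / D * r2 k) T = B2 / D * delivered s r2 T"
    unfolding delivered_def sum_distrib_left by (simp add: algebra_simps)
  ultimately show ?thesis using assms by (auto simp: completes_def)
qed

end


section \<open>Optimality certificates\<close>

text \<open>Optimality conditions of Karush-Kuhn-Tucker type, with the multiplier of user 2
  normalised to 1. The right-hand side for user 1 is the ratio of the partial derivatives when user
  1 has rate \<open>\<rho>\<close>, from which the rate of user 2 cancels. Positivity of
  \<open>r1\<close> makes idling strictly wasteful; the bound by \<open>\<rho>\<close> later yields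
  a lower bound on the cut-off in the recursion.\<close>

definition cutoff_certificate ::
  "real \<Rightarrow> (nat \<Rightarrow> real) \<Rightarrow> (nat \<Rightarrow> real) \<Rightarrow> real \<Rightarrow> (nat \<Rightarrow> real) \<Rightarrow> (nat \<Rightarrow> real)
     \<Rightarrow> real \<Rightarrow> (nat \<Rightarrow> real) \<Rightarrow> bool" where
  "cutoff_certificate \<sigma>2 s E T r1 r2 \<rho> \<mu> \<longleftrightarrow>
     (\<forall>k<num_epochs s T. 0 < r1 k \<and> r1 k \<le> \<rho> \<and> 0 < \<mu> k \<and>
        \<mu> k * 2 powr (2 * (r1 k + r2 k)) = 2 powr (2 * \<rho>) / (2 powr (2 * \<rho>) + \<sigma>2 - 1) \<and>
        1 \<le> \<mu> k * (2 powr (2 * (r1 k + r2 k)) + (\<sigma>2 - 1) * 2 powr (2 * r2 k)) \<and>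
        (r2 k = 0 \<or> \<mu> k * (2 powr (2 * (r1 k + r2 k)) + (\<sigma>2 - 1) * 2 powr (2 * r2 k)) = 1)) \<and>
     (\<forall>k. Suc k < num_epochs s T \<longrightarrow> \<mu> (Suc k) \<le> \<mu> k \<and>
        (\<mu> (Suc k) = \<mu> k \<or> cum_energy \<sigma>2 s T r1 r2 (Suc k) = sum E {..<Suc k})) \<and>
     cum_energy \<sigma>2 s T r1 r2 (num_epochs s T) = sum E {..<num_epochs s T}"

lemma brk_Suc_end: "\<not> brk s E T n < num_epochs s T \<Longrightarrow> brk s E T (Suc n) = num_epochs s T"
  by simp

declare brk.simps(2) [simp del]

context arrival_process
begin

text \<open>Suppose \<open>T' < T\<close>. Equal bits make the priced linear terms sum to 0, and
  they bound the priced energy difference from below, strictly in the last epoch. Abel summation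
  bounds the same difference above by 0.\<close>

lemma certificate_optimal:
  assumes \<sigma>: "1 \<le> \<sigma>2" and B1: "0 < B1"
    and cert: "cutoff_certificate \<sigma>2 s E T q1 q2 \<rho> \<mu>"
    and q: "completes \<sigma>2 s E B1 B2 T q1 q2"
    and r: "completes \<sigma>2 s E B1 B2 T' r1 r2"
  shows "T \<le> T'"
proof (rule ccontr)
  assume "\<not> T \<le> T'"
  then have less: "T' < T" by simp
  have T': "0 < T'" and T: "0 < T" using completes_pos[OF r B1] completes_pos[OF q B1] by auto
  define N where "N = num_epochs s T"
  define l l' where "l = epoch_len s T" and "l' = epoch_len s T'"
  define w where "w = 2 powr (2 * \<rho>) / (2 powr (2 * \<rho>) + \<sigma>2 - 1)"
  have N': "num_epochs s T' \<le> N" unfolding N_def using num_epochs_mono[of T' T] T' less by simp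
  have N: "0 < N" unfolding N_def by (rule num_epochs_pos)
  have l': "0 \<le> l' k" "l' k \<le> l k" for k
    using epoch_len_mono[of T' T s k] less by (auto simp: l_def l'_def)
  have B: "(\<Sum>k<N. q1 k * l k) = B1" "(\<Sum>k<N. q2 k * l k) = B2"
    "(\<Sum>k<N. r1 k * l' k) = B1" "(\<Sum>k<N. r2 k * l' k) = B2"
    using q r T T' N' unfolding N_def l_def l'_def
    by (auto simp: completes_def delivered_eq sum_epoch_len_extend)
  have r_causal: "energy_causal \<sigma>2 s E T' r1 r2" and q_causal: "energy_causal \<sigma>2 s E T q1 q2"
    using q r by (auto simp: completes_def)
  define lhs where "lhs k = 2 * ln 2 * (w * (r1 k * l' k - q1 k * l k) + (r2 k * l' k - q2 k * l k))" for k
  define d where "d k = bc_power \<sigma>2 (r1 k) (r2 k) * l' k - bc_power \<sigma>2 (q1 k) (q2 k) * l k" for k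
  have step: "lhs k \<le> \<mu> k * d k" "l' k < l k \<Longrightarrow> lhs k < \<mu> k * d k" if k: "k < N" for k
  proof -
    define X where "X = 2 powr (2 * (q1 k + q2 k))"
    define Z where "Z = (\<sigma>2 - 1) * 2 powr (2 * q2 k)"
    have c: "0 < q1 k" "0 < \<mu> k" "\<mu> k * X = w" "1 \<le> \<mu> k * (X + Z)" "q2 k = 0 \<or> \<mu> k * (X + Z) = 1"
      using cert k unfolding cutoff_certificate_def N_def w_def X_def Z_def by auto
    have q2: "0 \<le> q2 k" using q_causal k T \<sigma> by (auto simp: energy_causal_iff N_def)
    have "0 \<le> r2 k * l' k"
      using r_causal T' \<sigma> epoch_len_0[OF T', of k] l'(1)[of k]
      by (cases "k < num_epochs s T'") (auto simp: energy_causal_iff l'_def)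
    \<comment> \<open>Complementary slackness: the competitor's bits for user 2 are nonnegative, so
      a multiplier of at least 1 suffices; for the candidate's bits it is 1 or the rate is
      0.\<close>
    then have "r2 k * l' k \<le> \<mu> k * (X + Z) * (r2 k * l' k)"
      using c(4) by (metis mult_le_cancel_right1 mult.commute linorder_not_le mult_right_mono mult_1)
    then have "r2 k * l' k - q2 k * l k \<le> \<mu> k * (X + Z) * (r2 k * l' k - q2 k * l k)"
      using c(5) by auto
    then have "w * (r1 k * l' k - q1 k * l k) + (r2 k * l' k - q2 k * l k)
        \<le> \<mu> k * X * (r1 k * l' k - q1 k * l k) + \<mu> k * (X + Z) * (r2 k * l' k - q2 k * l k)"
      unfolding c(3) by linarith
    also have "\<dots> = \<mu> k * (X * (r1 k * l' k - q1 k * l k) + (X + Z) * (r2 k * l' k - q2 k * l k))"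
      by (simp add: algebra_simps)
    finally have "lhs k \<le> 2 * ln 2 * (\<mu> k * (X * (r1 k * l' k - q1 k * l k) + (X + Z) * (r2 k * l' k - q2 k * l k)))"
      unfolding lhs_def by (intro mult_left_mono) auto
    then have le: "lhs k \<le> \<mu> k * (2 * ln 2 * (X * (r1 k * l' k - q1 k * l k) + (X + Z) * (r2 k * l' k - q2 k * l k)))"
      by (simp add: mult.left_commute mult.assoc)
    have "2 * ln 2 * (X * (r1 k * l' k - q1 k * l k) + (X + Z) * (r2 k * l' k - q2 k * l k)) \<le> d k"
      unfolding d_def X_def Z_def by (rule bc_power_tangent_time(1)[OF \<sigma> l'])
    with le c(2) show "lhs k \<le> \<mu> k * d k"
      by (meson mult_left_mono order_trans less_imp_le)
    assume "l' k < l k"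
    then have "2 * ln 2 * (X * (r1 k * l' k - q1 k * l k) + (X + Z) * (r2 k * l' k - q2 k * l k)) < d k"
      unfolding d_def X_def Z_def using c(1) q2 by (intro bc_power_tangent_time(2)[OF \<sigma> l']) auto
    with le c(2) show "lhs k < \<mu> k * d k"
      by (meson mult_strict_left_mono order_le_less_trans)
  qed
  \<comment> \<open>The earlier deadline either misses the last epoch altogether or cuts it
    short.\<close>
  have last: "l' (N - 1) < l (N - 1)"
  proof (cases "num_epochs s T' \<le> N - 1")
    case True
    then have "l' (N - 1) = 0" by (simp add: l'_def epoch_len_0 T')
    then show ?thesis using epoch_len_pos[OF T, of "N - 1"] N by (simp add: l_def N_def)
  next
    case False
    then have eq: "num_epochs s T' = N" using N' N by simp
    have "s N \<ge> T" using le_s_num_epochs T by (simp add: N_def)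
    then show ?thesis using less N eq T T'
      by (simp add: l_def l'_def epoch_len_eq N_def)
  qed
  have "(\<Sum>k<N. lhs k) < (\<Sum>k<N. \<mu> k * d k)"
    using step last N by (intro sum_strict_mono_ex1) (auto intro!: bexI[of _ "N - 1"])
  moreover have "(\<Sum>k<N. lhs k) = 0"
    unfolding lhs_def sum_distrib_left[symmetric] sum.distrib sum_subtractf by (simp add: B)
  moreover have "(\<Sum>k<N. \<mu> k * d k) \<le> 0"
  proof (rule sum_mult_nonpos_Abel)
    have D: "(\<Sum>j<m. d j) \<le> sum E {..<m} - cum_energy \<sigma>2 s T q1 q2 m" for m
      using energy_causal_cum[OF T' \<sigma> r_causal, of m]
      by (simp add: d_def sum_subtractf l'_def l_def cum_energy_def)
    show "0 \<le> \<mu> k" if "k < N" for k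
      using cert that unfolding cutoff_certificate_def N_def by (auto intro: less_imp_le)
    show "\<mu> (Suc k) \<le> \<mu> k" if "Suc k < N" for k
      using cert that unfolding cutoff_certificate_def N_def by auto
    show "(\<Sum>j<Suc k. d j) \<le> 0" if "Suc k < N" "\<mu> (Suc k) \<noteq> \<mu> k" for k
      using cert that D[of "Suc k"] unfolding cutoff_certificate_def N_def by fastforce
    show "(\<Sum>j<N. d j) \<le> 0"
      using cert D[of N] unfolding cutoff_certificate_def N_def by auto
  qed
  ultimately show False by simp
qed


section \<open>The total power for a fixed deadline\<close>

lemma knot_eq: "0 < T \<Longrightarrow> k \<le> num_epochs s T \<Longrightarrow> knot s T k = min (s k) T"
  using less_num_epochs_iff[of T k] le_s_num_epochs[of T] by (auto simp: knot_def)

lemma knot_less: "0 < T \<Longrightarrow> i < j \<Longrightarrow> j \<le> num_epochs s T \<Longrightarrow> knot s T i < knot s T j"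
  using less_num_epochs_iff[of T i] by (simp add: knot_eq)

lemma knot_0: "0 < T \<Longrightarrow> knot s T 0 = 0"
  by (simp add: knot_eq s_0)

lemma epoch_len_knot: "0 < T \<Longrightarrow> k < num_epochs s T \<Longrightarrow> epoch_len s T k = knot s T (Suc k) - knot s T k"
  using less_num_epochs_iff[of T k] by (simp add: knot_eq epoch_len_eq)

lemma avg_power_knot: "avg_power (knot s T) E m i * (knot s T i - knot s T m) = sum E {..<i} - sum E {..<m}"
  if "0 < T" "m < i" "i \<le> num_epochs s T"
proof -
  have "sum E {..<m} + sum E {m..<i} = sum E {..<i}"
    using that sum.atLeastLessThan_concat[of 0 m i E] by (simp add: atLeast0LessThan)
  moreover have "knot s T i - knot s T m \<noteq> 0" using knot_less that by fastforce
  ultimately show ?thesis by (simp add: avg_power_def)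
qed

section \<open>Break points and slopes of the taut string\<close>

context
  fixes T :: real
  assumes T: "0 < T"
begin

lemma brk_Suc_bounds:
  assumes "brk s E T n < num_epochs s T"
  shows "brk s E T n < brk s E T (Suc n)" "brk s E T (Suc n) \<le> num_epochs s T"
proof -
  have "brk s E T (Suc n) \<in> {brk s E T n <.. num_epochs s T}"
    using assms arg_min_if_finite(1)[of "{brk s E T n <.. num_epochs s T}" "avg_power (knot s T) E (brk s E T n)"]
    by (simp add: brk.simps(2))
  then show "brk s E T n < brk s E T (Suc n)" "brk s E T (Suc n) \<le> num_epochs s T"
    by auto
qed

lemma seg_power_le:
  assumes "brk s E T n < i" "i \<le> num_epochs s T"
  shows "seg_power s E T n \<le> avg_power (knot s T) E (brk s E T n) i"
  unfolding seg_power_def using assms by (auto simp: brk.simps(2) intro!: arg_min_least)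

lemma brk_le: "brk s E T n \<le> num_epochs s T"
  using brk_Suc_bounds(2) by (induction n) (auto simp: brk.simps(2))

lemma brk_le_Suc: "brk s E T n \<le> brk s E T (Suc n)"
  using brk_Suc_bounds(1)[of n] brk_le[of n] by (cases "brk s E T n < num_epochs s T") (auto simp: brk_Suc_end)

lemma brk_mono: "n \<le> m \<Longrightarrow> brk s E T n \<le> brk s E T m"
  by (rule lift_Suc_mono_le[of "brk s E T", OF brk_le_Suc])

text \<open>Each break point advances by at least one index until the end is reached; hence
  \<open>num_epochs s T\<close> steps always suffice.\<close>

lemma min_le_brk: "min n (num_epochs s T) \<le> brk s E T n"
proof (induction n)
  case (Suc n)
  then show ?case using brk_Suc_bounds(1)[of n] by (cases "brk s E T n < num_epochs s T") (auto simp: brk_Suc_end)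
qed simp

lemma brk_num_epochs: "brk s E T (num_epochs s T) = num_epochs s T"
  using min_le_brk[of "num_epochs s T"] brk_le[of "num_epochs s T"] by simp

lemma total_power_eq:
  assumes "brk s E T n \<le> k" "k < brk s E T (Suc n)"
  shows "total_power s E T k = seg_power s E T n"
proof -
  have "(THE n. brk s E T n \<le> k \<and> k < brk s E T (Suc n)) = n"
  proof (rule the_equality)
    fix m assume m: "brk s E T m \<le> k \<and> k < brk s E T (Suc m)"
    show "m = n"
    proof (rule ccontr)
      assume "m \<noteq> n"
      then have "Suc m \<le> n \<or> Suc n \<le> m" by auto
      then show False using m assms brk_mono[of "Suc m" n] brk_mono[of "Suc n" m] by linarith
    qed
  qed (use assms in auto)
  then show ?thesis by (simp add: total_power_def)
qed

lemma segment_exists: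
  assumes "k < num_epochs s T"
  obtains n where "brk s E T n \<le> k" "k < brk s E T (Suc n)"
proof -
  have ex: "k < brk s E T (num_epochs s T)" using brk_num_epochs assms by simp
  define m where "m = (LEAST m. k < brk s E T m)"
  have m: "k < brk s E T m" unfolding m_def by (rule LeastI[of "\<lambda>m. k < brk s E T m", OF ex])
  then obtain n where n: "m = Suc n" by (cases m) auto
  have "\<not> k < brk s E T n" using not_less_Least[of n "\<lambda>m. k < brk s E T m"] n m_def by simp
  then show ?thesis using that[of n] m n by simp
qed

text \<open>The function of the power is left arbitrary because the identity gives energy and
  \<open>user2_rate\<close> gives the bits of user 2.\<close>

lemma sum_within_segment:
  fixes \<phi> :: "real \<Rightarrow> real"
  assumes "brk s E T n \<le> m" "m \<le> brk s E T (Suc n)"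
  shows "(\<Sum>k=brk s E T n..<m. \<phi> (total_power s E T k) * epoch_len s T k)
     = \<phi> (seg_power s E T n) * (knot s T m - knot s T (brk s E T n))"
proof -
  have "(\<Sum>k=brk s E T n..<m. \<phi> (total_power s E T k) * epoch_len s T k)
     = (\<Sum>k=brk s E T n..<m. \<phi> (seg_power s E T n) * (knot s T (Suc k) - knot s T k))"
  proof (intro sum.cong refl)
    fix k assume k: "k \<in> {brk s E T n..<m}"
    then have "k < num_epochs s T" using assms brk_le[of "Suc n"] by auto
    then show "\<phi> (total_power s E T k) * epoch_len s T k = \<phi> (seg_power s E T n) * (knot s T (Suc k) - knot s T k)"
      using k assms by (simp add: epoch_len_knot T total_power_eq[of n k])
  qed
  then show ?thesis
    using assms by (simp add: sum_distrib_left[symmetric] sum_Suc_diff')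
qed

lemma sum_segments:
  fixes \<phi> :: "real \<Rightarrow> real"
  shows "(\<Sum>m<n. \<phi> (seg_power s E T m) * (knot s T (brk s E T (Suc m)) - knot s T (brk s E T m)))
     = (\<Sum>k<brk s E T n. \<phi> (total_power s E T k) * epoch_len s T k)"
proof (induction n)
  case (Suc n)
  have "(\<Sum>k<brk s E T (Suc n). \<phi> (total_power s E T k) * epoch_len s T k) =
     (\<Sum>k<brk s E T n. \<phi> (total_power s E T k) * epoch_len s T k)
     + (\<Sum>k=brk s E T n..<brk s E T (Suc n). \<phi> (total_power s E T k) * epoch_len s T k)"
    unfolding lessThan_atLeast0 by (rule sum.atLeastLessThan_concat[symmetric]) (auto intro: brk_le_Suc)
  then show ?case using Suc sum_within_segment[OF brk_le_Suc order_refl, where \<phi>=\<phi> and n=n] by simp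
qed simp

lemma sum_all_segments:
  fixes \<phi> :: "real \<Rightarrow> real"
  shows "(\<Sum>n | brk s E T n < num_epochs s T.
       \<phi> (seg_power s E T n) * (knot s T (brk s E T (Suc n)) - knot s T (brk s E T n)))
     = (\<Sum>k<num_epochs s T. \<phi> (total_power s E T k) * epoch_len s T k)"
proof -
  have sub: "{n. brk s E T n < num_epochs s T} \<subseteq> {..<num_epochs s T}"
    using brk_mono brk_num_epochs by (metis (no_types, lifting) lessThan_iff linorder_not_le mem_Collect_eq subsetI)
  have "(\<Sum>n | brk s E T n < num_epochs s T.
       \<phi> (seg_power s E T n) * (knot s T (brk s E T (Suc n)) - knot s T (brk s E T n))) =
    (\<Sum>n<num_epochs s T.
       \<phi> (seg_power s E T n) * (knot s T (brk s E T (Suc n)) - knot s T (brk s E T n)))"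
  proof (intro sum.mono_neutral_left ballI)
    fix n assume "n \<in> {..<num_epochs s T} - {n. brk s E T n < num_epochs s T}"
    then have "brk s E T n = num_epochs s T" using brk_le[of n] by simp
    moreover from this have "brk s E T (Suc n) = num_epochs s T" by (simp add: brk_Suc_end)
    ultimately show "\<phi> (seg_power s E T n) * (knot s T (brk s E T (Suc n)) - knot s T (brk s E T n)) = 0" by simp
  qed (use sub in auto)
  then show ?thesis unfolding sum_segments brk_num_epochs .
qed

lemma cum_total_power_brk: "(\<Sum>k<brk s E T n. total_power s E T k * epoch_len s T k) = sum E {..<brk s E T n}"
proof -
  have "(\<Sum>k<brk s E T n. total_power s E T k * epoch_len s T k) =
    (\<Sum>m<n. sum E {..<brk s E T (Suc m)} - sum E {..<brk s E T m})"
    unfolding sum_segments[where \<phi> = "\<lambda>x. x", symmetric]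
  proof (intro sum.cong refl)
    fix m
    show "seg_power s E T m * (knot s T (brk s E T (Suc m)) - knot s T (brk s E T m)) =
      sum E {..<brk s E T (Suc m)} - sum E {..<brk s E T m}"
    proof (cases "brk s E T m < num_epochs s T")
      case True
      then show ?thesis unfolding seg_power_def using brk_Suc_bounds[of m] T by (intro avg_power_knot) auto
    next
      case False
      then have "brk s E T m = num_epochs s T" "brk s E T (Suc m) = num_epochs s T"
        using brk_le[of m] by (auto simp: brk_Suc_end)
      then show ?thesis by simp
    qed
  qed
  also have "\<dots> = sum E {..<brk s E T n}"
    by (subst sum_lessThan_telescope) simp
  finally show ?thesis .
qed

text \<open>A segment starts with all harvested energy spent, and its slope is the least average
  towards any later knot, so within it the string stays below every corner.\<close>

lemma cum_total_power_le:
  assumes "m \<le> num_epochs s T"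
  shows "(\<Sum>k<m. total_power s E T k * epoch_len s T k) \<le> sum E {..<m}"
proof (cases "m = num_epochs s T")
  case True
  then show ?thesis using cum_total_power_brk[of "num_epochs s T"] brk_num_epochs by simp
next
  case False
  then obtain n where n: "brk s E T n \<le> m" "m < brk s E T (Suc n)"
    using segment_exists[of m] assms by auto
  have "(\<Sum>k<m. total_power s E T k * epoch_len s T k) = sum E {..<brk s E T n}
    + (\<Sum>k=brk s E T n..<m. total_power s E T k * epoch_len s T k)"
    using sum.atLeastLessThan_concat[of 0 "brk s E T n" m "\<lambda>k. total_power s E T k * epoch_len s T k"] n(1)
      cum_total_power_brk[of n]
    by (simp add: lessThan_atLeast0)
  also have "(\<Sum>k=brk s E T n..<m. total_power s E T k * epoch_len s T k)
    = seg_power s E T n * (knot s T m - knot s T (brk s E T n))"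
    using sum_within_segment[where \<phi> = "\<lambda>x. x"] n by simp
  also have "\<dots> \<le> sum E {..<m} - sum E {..<brk s E T n}"
  proof (cases "brk s E T n = m")
    case False
    then have less: "brk s E T n < m" using n by simp
    have "seg_power s E T n * (knot s T m - knot s T (brk s E T n))
       \<le> avg_power (knot s T) E (brk s E T n) m * (knot s T m - knot s T (brk s E T n))"
      using seg_power_le[OF less assms] knot_less[OF T less assms] by (intro mult_right_mono) auto
    then show ?thesis using avg_power_knot[OF T less assms] by simp
  qed simp
  finally show ?thesis by simp
qed

lemma cum_total_power:
  "(\<Sum>k<num_epochs s T. total_power s E T k * epoch_len s T k) = sum E {..<num_epochs s T}"
  using cum_total_power_brk[of "num_epochs s T"] brk_num_epochs by simp

text \<open>Minimality of the first slope is tested at the end of the second segment: the average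
  over both is at least the first slope, hence so is the average over the second alone.\<close>

lemma seg_power_mono:
  assumes "brk s E T (Suc n) < num_epochs s T"
  shows "seg_power s E T n \<le> seg_power s E T (Suc n)"
proof -
  let ?a = "brk s E T n" and ?b = "brk s E T (Suc n)" and ?c = "brk s E T (Suc (Suc n))" and ?k = "knot s T"
  have N: "?a < num_epochs s T" using assms brk_le_Suc[of n] by linarith
  note bounds = brk_Suc_bounds[OF N] brk_Suc_bounds[OF assms]
  have ac: "?a < ?c" using bounds by linarith
  have "seg_power s E T n * (?k ?c - ?k ?a) \<le> avg_power ?k E ?a ?c * (?k ?c - ?k ?a)"
    using seg_power_le[OF ac bounds(4)] knot_less[OF T ac bounds(4)] by (intro mult_right_mono) auto
  also have "\<dots> = sum E {..<?c} - sum E {..<?a}" by (rule avg_power_knot[OF T ac bounds(4)])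
  finally have 1: "seg_power s E T n * (?k ?c - ?k ?a) \<le> sum E {..<?c} - sum E {..<?a}" .
  have 2: "seg_power s E T n * (?k ?b - ?k ?a) = sum E {..<?b} - sum E {..<?a}"
    unfolding seg_power_def by (rule avg_power_knot[OF T bounds(1,2)])
  have 3: "seg_power s E T (Suc n) * (?k ?c - ?k ?b) = sum E {..<?c} - sum E {..<?b}"
    unfolding seg_power_def by (rule avg_power_knot[OF T bounds(3,4)])
  have "seg_power s E T n * (?k ?c - ?k ?b) \<le> seg_power s E T (Suc n) * (?k ?c - ?k ?b)"
    using 1 2 3 by (simp only: right_diff_distrib)
  then show ?thesis using knot_less[OF T bounds(3,4)] by (simp add: mult_le_cancel_right)
qed

lemma total_power_Suc:
  assumes "Suc k < num_epochs s T"
  shows "total_power s E T k \<le> total_power s E T (Suc k)"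
    and "total_power s E T (Suc k) \<noteq> total_power s E T k \<Longrightarrow>
      (\<Sum>j<Suc k. total_power s E T j * epoch_len s T j) = sum E {..<Suc k}"
proof -
  obtain n where n: "brk s E T n \<le> k" "k < brk s E T (Suc n)"
    using segment_exists[of k] assms by auto
  have "total_power s E T k \<le> total_power s E T (Suc k) \<and>
     (total_power s E T (Suc k) \<noteq> total_power s E T k \<longrightarrow>
      (\<Sum>j<Suc k. total_power s E T j * epoch_len s T j) = sum E {..<Suc k})"
  proof (cases "Suc k < brk s E T (Suc n)")
    case True
    then show ?thesis using n by (simp add: total_power_eq[of n])
  next
    case False
    then have eq: "brk s E T (Suc n) = Suc k" using n by simp
    then have "Suc k < brk s E T (Suc (Suc n))" using brk_Suc_bounds(1)[of "Suc n"] assms by simp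
    then have "total_power s E T (Suc k) = seg_power s E T (Suc n)"
      using eq by (intro total_power_eq) (auto)
    moreover have "total_power s E T k = seg_power s E T n" using n by (intro total_power_eq)
    ultimately show ?thesis
      using seg_power_mono[of n] cum_total_power_brk[of "Suc n"] assms unfolding eq by simp
  qed
  then show "total_power s E T k \<le> total_power s E T (Suc k)"
    "total_power s E T (Suc k) \<noteq> total_power s E T k \<Longrightarrow>
      (\<Sum>j<Suc k. total_power s E T j * epoch_len s T j) = sum E {..<Suc k}" by auto
qed

text \<open>Slopes are nondecreasing, so only the first segment matters, and it spends exactly the
  energy harvested up to its end knot.\<close>

lemma total_power_ge:
  assumes "\<And>j. 0 < j \<Longrightarrow> j \<le> num_epochs s T \<Longrightarrow> q * knot s T j \<le> sum E {..<j}"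
    and "k < num_epochs s T"
  shows "q \<le> total_power s E T k"
  using assms(2)
proof (induction k)
  case 0
  let ?b = "brk s E T (Suc 0)"
  have b: "brk s E T 0 < ?b" "?b \<le> num_epochs s T"
    using brk_Suc_bounds[of 0] num_epochs_pos by auto
  have "total_power s E T 0 = seg_power s E T 0"
    using b by (intro total_power_eq) (auto)
  moreover have "seg_power s E T 0 * (knot s T ?b - knot s T 0) = sum E {..<?b}"
    using avg_power_knot[OF T b] by (simp add: seg_power_def)
  moreover have "q * knot s T ?b \<le> sum E {..<?b}" using assms(1) b by auto
  moreover have "0 < knot s T ?b" using knot_less[OF T, of 0 ?b] b knot_0[OF T] by auto
  ultimately show ?case by (simp add: knot_0[OF T]) (metis mult_le_cancel_right_pos)
next
  case (Suc k)
  then show ?case using total_power_Suc(1)[of k] by auto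
qed

lemma total_power_nonneg: "k < num_epochs s T \<Longrightarrow> 0 \<le> total_power s E T k"
  by (rule total_power_ge) (auto intro: sum_nonneg E_nonneg)

end

end


section \<open>Cut-off policies\<close>

text \<open>The rate of user 2 is a difference of a function of the total power and one of the
  cut-off (\<open>user2_rate_diff\<close>). This is the first part summed over time; it depends on
  the deadline but not on the cut-off.\<close>

definition string_value :: "real \<Rightarrow> (nat \<Rightarrow> real) \<Rightarrow> (nat \<Rightarrow> real) \<Rightarrow> real \<Rightarrow> real" where
  "string_value \<sigma>2 s E T =
     (\<Sum>k<num_epochs s T. 1 / 2 * log 2 (total_power s E T k + \<sigma>2) * epoch_len s T k)"

lemma sum_lessThan_add: "(\<Sum>k<i + m. f k) = (\<Sum>k<i. f k) + (\<Sum>k<m. f (i + k))"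
  for f :: "nat \<Rightarrow> real" and i m :: nat
  by (induction m) (auto simp: algebra_simps)

lemma epoch_len_shift: "epoch_len (\<lambda>k. s (i + k) - s i) T' k = epoch_len s (s i + T') (i + k)"
  by (auto simp: epoch_len_def min_def max_def)

context arrival_process
begin

lemma energy_causal_iff_cum:
  assumes "0 < T" "1 \<le> \<sigma>2"
  shows "energy_causal \<sigma>2 s E T r1 r2 \<longleftrightarrow>
    (\<forall>k<num_epochs s T. 0 \<le> r1 k \<and> 0 \<le> r2 k) \<and>
    (\<forall>m\<le>num_epochs s T. cum_energy \<sigma>2 s T r1 r2 m \<le> sum E {..<m})"
  using energy_causal_iff[OF assms] by (simp add: cum_energy_def)

lemma bits2_eq:
  assumes "0 < T"
  shows "bits2 \<sigma>2 s E T p = (\<Sum>k<num_epochs s T. user2_rate \<sigma>2 (total_power s E T k) p * epoch_len s T k)"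
  unfolding bits2_def by (rule sum_all_segments[OF assms, where \<phi> = "\<lambda>x. user2_rate \<sigma>2 x p"])

lemma bits2_string_value:
  assumes "0 < T" "0 \<le> p" "0 < \<sigma>2"
  shows "bits2 \<sigma>2 s E T p = string_value \<sigma>2 s E T - 1 / 2 * log 2 (p + \<sigma>2) * T"
proof -
  have "bits2 \<sigma>2 s E T p = (\<Sum>k<num_epochs s T. 1 / 2 * log 2 (total_power s E T k + \<sigma>2) * epoch_len s T k
      - 1 / 2 * log 2 (p + \<sigma>2) * epoch_len s T k)"
    unfolding bits2_eq[OF assms(1)]
    using assms by (intro sum.cong refl) (simp add: user2_rate_diff total_power_nonneg left_diff_distrib)
  then show ?thesis
    unfolding sum_subtractf sum_distrib_left[symmetric] string_value_def using assms(1) by (simp add: sum_epoch_len)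
qed

text \<open>The bound \<open>p \<le> total_power s E T k\<close> leaves user 2 a nonnegative rate.
  The price is the reciprocal of \<open>P + \<sigma>2\<close>, the partial derivative in the rate of
  user 2 up to \<open>2 * ln 2\<close>; the multiplier of user 1 is then
  \<open>(1 + p) / (p + \<sigma>2)\<close> in every epoch.\<close>

lemma cutoff_policy:
  assumes \<sigma>: "1 < \<sigma>2" and T: "0 < T" and p: "0 < p"
    and ge: "\<And>k. k < num_epochs s T \<Longrightarrow> p \<le> total_power s E T k"
  defines "r1 \<equiv> \<lambda>_. awgn_rate p" and "r2 \<equiv> \<lambda>k. user2_rate \<sigma>2 (total_power s E T k) p"
  shows cutoff_policy_cum: "\<And>m. m \<le> num_epochs s T \<Longrightarrow>
      cum_energy \<sigma>2 s T r1 r2 m = (\<Sum>k<m. total_power s E T k * epoch_len s T k)"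
    and cutoff_policy_causal: "energy_causal \<sigma>2 s E T r1 r2"
    and cutoff_policy_delivered1: "delivered s r1 T = awgn_rate p * T"
    and cutoff_policy_delivered2: "delivered s r2 T = bits2 \<sigma>2 s E T p"
    and cutoff_policy_certificate:
      "cutoff_certificate \<sigma>2 s E T r1 r2 (awgn_rate p) (\<lambda>k. 1 / (total_power s E T k + \<sigma>2))"
proof -
  show cum: "cum_energy \<sigma>2 s T r1 r2 m = (\<Sum>k<m. total_power s E T k * epoch_len s T k)"
    if "m \<le> num_epochs s T" for m
    unfolding cum_energy_def r1_def r2_def
    using that ge p \<sigma> by (intro sum.cong refl) (simp add: bc_power_split)
  have "0 \<le> r1 k" "0 \<le> r2 k" if "k < num_epochs s T" for k
    using that p \<sigma> ge[OF that] by (auto simp: r1_def r2_def awgn_rate_nonneg user2_rate_nonneg)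
  then show "energy_causal \<sigma>2 s E T r1 r2"
    using \<sigma> T cum cum_total_power_le by (subst energy_causal_iff_cum) auto
  show "delivered s r1 T = awgn_rate p * T"
    unfolding delivered_eq[OF T] r1_def by (simp add: sum_distrib_left[symmetric] sum_epoch_len T)
  show "delivered s r2 T = bits2 \<sigma>2 s E T p"
    unfolding delivered_eq[OF T] bits2_eq[OF T] r2_def ..
  show "cutoff_certificate \<sigma>2 s E T r1 r2 (awgn_rate p) (\<lambda>k. 1 / (total_power s E T k + \<sigma>2))"
    unfolding cutoff_certificate_def
  proof (intro conjI allI impI)
    fix k assume k: "k < num_epochs s T"
    let ?P = "total_power s E T k"
    have P: "0 < ?P + \<sigma>2" "0 \<le> ?P" using ge[OF k] p \<sigma> by auto
    show "0 < r1 k" "r1 k \<le> awgn_rate p" using p by (auto simp: r1_def awgn_rate_pos)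
    show "0 < 1 / (?P + \<sigma>2)" using P by simp
    have X: "2 powr (2 * (r1 k + r2 k)) = (1 + p) * ((?P + \<sigma>2) / (p + \<sigma>2))"
      using p \<sigma> P by (simp only: distrib_left[of 2] powr_add) (simp add: r1_def r2_def awgn_rate_powr user2_rate_powr)
    have Y: "2 powr (2 * r2 k) = (?P + \<sigma>2) / (p + \<sigma>2)"
      using p \<sigma> P by (simp add: r2_def user2_rate_powr)
    have pn: "p + \<sigma>2 \<noteq> 0" "?P + \<sigma>2 \<noteq> 0" using p \<sigma> P by auto
    show "1 / (?P + \<sigma>2) * 2 powr (2 * (r1 k + r2 k))
      = 2 powr (2 * awgn_rate p) / (2 powr (2 * awgn_rate p) + \<sigma>2 - 1)"
      unfolding X using p pn by (simp add: awgn_rate_powr)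
    have sum: "2 powr (2 * (r1 k + r2 k)) + (\<sigma>2 - 1) * 2 powr (2 * r2 k) = ?P + \<sigma>2"
    proof -
      have "2 powr (2 * (r1 k + r2 k)) + (\<sigma>2 - 1) * 2 powr (2 * r2 k)
         = (p + \<sigma>2) * ((?P + \<sigma>2) / (p + \<sigma>2))"
        unfolding X Y by (simp only: distrib_right[symmetric]) simp
      then show ?thesis using pn by simp
    qed
    show "1 \<le> 1 / (?P + \<sigma>2) * (2 powr (2 * (r1 k + r2 k)) + (\<sigma>2 - 1) * 2 powr (2 * r2 k))"
      "r2 k = 0 \<or> 1 / (?P + \<sigma>2) * (2 powr (2 * (r1 k + r2 k)) + (\<sigma>2 - 1) * 2 powr (2 * r2 k)) = 1"
      unfolding sum using pn by auto
  next
    fix k assume k: "Suc k < num_epochs s T"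
    show "1 / (total_power s E T (Suc k) + \<sigma>2) \<le> 1 / (total_power s E T k + \<sigma>2)"
      using total_power_Suc(1)[OF T k] ge[of k] k p \<sigma> by (intro divide_left_mono mult_pos_pos) auto
    show "1 / (total_power s E T (Suc k) + \<sigma>2) = 1 / (total_power s E T k + \<sigma>2) \<or>
       cum_energy \<sigma>2 s T r1 r2 (Suc k) = sum E {..<Suc k}"
      using total_power_Suc(2)[OF T k] cum[of "Suc k"] k by auto
  next
    show "cum_energy \<sigma>2 s T r1 r2 (num_epochs s T) = sum E {..<num_epochs s T}"
      using cum[of "num_epochs s T"] cum_total_power[OF T] by simp
  qed
qed


section \<open>Shifting and concatenation\<close>

lemma arrival_process_shift:
  assumes "0 < E i"
  shows "arrival_process (\<lambda>k. s (i + k) - s i) (\<lambda>k. E (i + k))"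
proof
  show "s (i + 0) - s i = 0" "0 < E (i + 0)" using assms by auto
  show "strict_mono (\<lambda>k. s (i + k) - s i)" by (rule strict_monoI) simp
  show "0 \<le> E (i + k)" for k by (rule E_nonneg)
  show "finite {k. s (i + k) - s i < T}" for T
  proof -
    have "(\<lambda>k. i + k) ` {k. s (i + k) - s i < T} \<subseteq> {k. s k < T + s i}" by auto
    then have "finite ((\<lambda>k. i + k) ` {k. s (i + k) - s i < T})" using s_fin finite_subset by blast
    then show ?thesis by (rule finite_imageD) simp
  qed
qed

lemma E_cum_shift: "(\<Sum>k<m. E (i + k)) = sum E {..<i + m} - sum E {..<i}"
  using sum_lessThan_add[of E i m] by simp

lemma num_epochs_shift:
  assumes "0 < E i" "0 < T'"
  shows "num_epochs s (s i + T') = i + num_epochs (\<lambda>k. s (i + k) - s i) T'"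
proof -
  interpret sub: arrival_process "\<lambda>k. s (i + k) - s i" "\<lambda>k. E (i + k)"
    by (rule arrival_process_shift[OF assms(1)])
  have T: "0 < s i + T'" using assms s_nonneg[of i] by linarith
  have iff: "k < num_epochs s (s i + T') \<longleftrightarrow> k < i + num_epochs (\<lambda>k. s (i + k) - s i) T'" for k
  proof (cases "k < i")
    case True
    then have "s k < s i" by simp
    then have "s k < s i + T'" using assms by linarith
    then show ?thesis using True less_num_epochs_iff[OF T] by auto
  next
    case False
    then have "k < i + num_epochs (\<lambda>k. s (i + k) - s i) T' \<longleftrightarrow> k - i < num_epochs (\<lambda>k. s (i + k) - s i) T'"
      by auto
    also have "\<dots> \<longleftrightarrow> s (i + (k - i)) - s i < T'" by (rule sub.less_num_epochs_iff[OF assms(2)])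
    also have "\<dots> \<longleftrightarrow> k < num_epochs s (s i + T')"
      using False unfolding less_num_epochs_iff[OF T] by (simp add: less_diff_eq diff_less_eq add.commute)
    finally show ?thesis by simp
  qed
  have "{..<num_epochs s (s i + T')} = {..<i + num_epochs (\<lambda>k. s (i + k) - s i) T'}"
    by (rule set_eqI) (simp only: lessThan_iff iff)
  then show ?thesis by (simp only: lessThan_eq_iff)
qed

section \<open>A constant-power prefix followed by a policy for the shifted arrivals\<close>

context
  fixes i :: nat and T' P \<sigma>2 :: real and r1 r2 :: "nat \<Rightarrow> real"
  assumes E_i: "0 < E i" and T': "0 < T'" and P: "0 < P"
begin

lemma epoch_len_before: "k < i \<Longrightarrow> epoch_len s (s i + T') k = s (Suc k) - s k"
proof -
  assume "k < i"
  then have "s (Suc k) \<le> s i" by simp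
  then have "s (Suc k) \<le> s i + T'" using T' by linarith
  then show ?thesis by (simp add: epoch_len_def)
qed

lemma cum_energy_concat_before:
  assumes "m \<le> i"
  shows "cum_energy \<sigma>2 s (s i + T') (\<lambda>k. if k < i then awgn_rate P else r1 (k - i))
      (\<lambda>k. if k < i then 0 else r2 (k - i)) m = P * s m"
proof -
  have "cum_energy \<sigma>2 s (s i + T') (\<lambda>k. if k < i then awgn_rate P else r1 (k - i))
      (\<lambda>k. if k < i then 0 else r2 (k - i)) m = (\<Sum>k<m. P * (s (Suc k) - s k))"
    unfolding cum_energy_def using assms P
    by (intro sum.cong refl) (simp add: epoch_len_before bc_power_user1)
  also have "\<dots> = P * s m"
    by (simp add: sum_distrib_left[symmetric] sum_lessThan_telescope s_0)
  finally show ?thesis .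
qed

lemma cum_energy_concat:
  "cum_energy \<sigma>2 s (s i + T') (\<lambda>k. if k < i then awgn_rate P else r1 (k - i))
      (\<lambda>k. if k < i then 0 else r2 (k - i)) (i + m)
   = P * s i + cum_energy \<sigma>2 (\<lambda>k. s (i + k) - s i) T' r1 r2 m"
  using cum_energy_concat_before[of i]
  unfolding cum_energy_def sum_lessThan_add epoch_len_shift by simp

lemma delivered_concat:
  "delivered s (\<lambda>k. if k < i then c else r1 (k - i)) (s i + T')
    = c * s i + delivered (\<lambda>k. s (i + k) - s i) r1 T'"
proof -
  interpret sub: arrival_process "\<lambda>k. s (i + k) - s i" "\<lambda>k. E (i + k)"
    by (rule arrival_process_shift[OF E_i])
  have T: "0 < s i + T'" using T' s_nonneg[of i] by linarith
  have "(\<Sum>k<i. (if k < i then c else r1 (k - i)) * epoch_len s (s i + T') k) = (\<Sum>k<i. c * (s (Suc k) - s k))"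
    by (intro sum.cong refl) (simp add: epoch_len_before)
  also have "\<dots> = c * s i"
    by (simp add: sum_distrib_left[symmetric] sum_lessThan_telescope s_0)
  finally show ?thesis
    unfolding delivered_eq[OF T] sub.delivered_eq[OF T'] num_epochs_shift[OF E_i T'] sum_lessThan_add epoch_len_shift
    by simp
qed

lemma energy_causal_concat:
  assumes \<sigma>: "1 \<le> \<sigma>2"
    and sub: "energy_causal \<sigma>2 (\<lambda>k. s (i + k) - s i) (\<lambda>k. E (i + k)) T' r1 r2"
    and P_le: "\<And>m. m \<le> i \<Longrightarrow> P * s m \<le> sum E {..<m}"
  shows "energy_causal \<sigma>2 s E (s i + T') (\<lambda>k. if k < i then awgn_rate P else r1 (k - i))
      (\<lambda>k. if k < i then 0 else r2 (k - i))"
proof -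
  interpret sub: arrival_process "\<lambda>k. s (i + k) - s i" "\<lambda>k. E (i + k)"
    by (rule arrival_process_shift[OF E_i])
  have T: "0 < s i + T'" using T' s_nonneg[of i] by linarith
  note sub = sub[unfolded sub.energy_causal_iff_cum[OF T' \<sigma>]]
  show ?thesis
    unfolding energy_causal_iff_cum[OF T \<sigma>] num_epochs_shift[OF E_i T']
  proof (intro conjI allI impI)
    fix k assume "k < i + num_epochs (\<lambda>k. s (i + k) - s i) T'"
    then show "0 \<le> (if k < i then awgn_rate P else r1 (k - i))" "0 \<le> (if k < i then 0 else r2 (k - i))"
      using sub P by (auto simp: awgn_rate_nonneg)
  next
    fix m assume m: "m \<le> i + num_epochs (\<lambda>k. s (i + k) - s i) T'"
    show "cum_energy \<sigma>2 s (s i + T') (\<lambda>k. if k < i then awgn_rate P else r1 (k - i))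
      (\<lambda>k. if k < i then 0 else r2 (k - i)) m \<le> sum E {..<m}"
    proof (cases "m \<le> i")
      case True
      then show ?thesis using P_le by (simp add: cum_energy_concat_before)
    next
      case False
      then obtain m' where m': "m = i + m'" by (metis le_Suc_ex nle_le)
      have "cum_energy \<sigma>2 (\<lambda>k. s (i + k) - s i) T' r1 r2 m' \<le> sum E {..<i + m'} - sum E {..<i}"
        using sub m m' by (auto simp: E_cum_shift[symmetric])
      then show ?thesis using P_le[of i] unfolding m' cum_energy_concat by simp
    qed
  qed
qed

text \<open>In the prefix user 2 is silent, so only an inequality is needed for its multiplier;
  it holds because the cut-off rate is at least the prefix rate.\<close>
lemma certificate_concat:
  assumes \<sigma>: "1 < \<sigma>2"
    and causal: "energy_causal \<sigma>2 (\<lambda>k. s (i + k) - s i) (\<lambda>k. E (i + k)) T' r1 r2"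
    and cert: "cutoff_certificate \<sigma>2 (\<lambda>k. s (i + k) - s i) (\<lambda>k. E (i + k)) T' r1 r2 \<rho> \<mu>"
    and P_eq: "P * s i = sum E {..<i}"
    and \<rho>: "awgn_rate P \<le> \<rho>" and r1_0: "awgn_rate P \<le> r1 0"
  shows "\<exists>\<mu>. cutoff_certificate \<sigma>2 s E (s i + T') (\<lambda>k. if k < i then awgn_rate P else r1 (k - i))
      (\<lambda>k. if k < i then 0 else r2 (k - i)) \<rho> \<mu>"
proof
  interpret sub: arrival_process "\<lambda>k. s (i + k) - s i" "\<lambda>k. E (i + k)"
    by (rule arrival_process_shift[OF E_i])
  let ?s' = "\<lambda>k. s (i + k) - s i"
  let ?r1 = "\<lambda>k. if k < i then awgn_rate P else r1 (k - i)"
  let ?r2 = "\<lambda>k. if k < i then 0 else r2 (k - i)"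
  define N' where "N' = num_epochs ?s' T'"
  define A where "A = 2 powr (2 * \<rho>)"
  define w where "w = A / (A + \<sigma>2 - 1)"
  \<comment> \<open>With user 2 silent at power \<open>P\<close>, the derivative for user 1 is
    \<open>1 + P\<close> up to \<open>2 * ln 2\<close>, so this is the price that turns it into
    \<open>w\<close>.\<close>
  define \<mu>' where "\<mu>' k = (if k < i then w / (1 + P) else \<mu> (k - i))" for k
  have A: "1 + P \<le> A"
    using powr_mono[of "2 * awgn_rate P" "2 * \<rho>" 2] \<rho> P by (simp add: A_def awgn_rate_powr)
  have w: "0 < w" using A P \<sigma> by (simp add: w_def)
  have N': "0 < N'" unfolding N'_def by (rule sub.num_epochs_pos)
  note cert = cert[unfolded cutoff_certificate_def, folded N'_def A_def, folded w_def]
  have r2_0: "0 \<le> r2 0" using causal T' \<sigma> N' sub.energy_causal_iff_cum[OF T', of \<sigma>2 r1 r2] N'_def by auto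
  \<comment> \<open>The price must not rise at the junction. There the sum rate cannot fall, and the
    price is \<open>w\<close> divided by its exponential.\<close>
  have "1 + P \<le> 2 powr (2 * (r1 0 + r2 0))"
    using powr_mono[of "2 * awgn_rate P" "2 * (r1 0 + r2 0)" 2] r1_0 r2_0 P by (simp add: awgn_rate_powr)
  moreover have "0 < \<mu> 0" "\<mu> 0 * 2 powr (2 * (r1 0 + r2 0)) = w" using cert N' by auto
  ultimately have "\<mu> 0 * (1 + P) \<le> w" by (metis mult_left_mono less_imp_le)
  then have \<mu>0: "\<mu> 0 \<le> w / (1 + P)" using P by (simp add: field_simps)
  show "cutoff_certificate \<sigma>2 s E (s i + T') ?r1 ?r2 \<rho> \<mu>'"
    unfolding cutoff_certificate_def num_epochs_shift[OF E_i T'] N'_def[symmetric] A_def[symmetric]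
    unfolding w_def[symmetric]
  proof (intro conjI allI impI, goal_cases)
    case (1 k)
    then show ?case using cert P by (auto simp: awgn_rate_pos)
  next
    case (2 k)
    then show ?case using cert \<rho> by auto
  next
    case (3 k)
    then show ?case using cert w P by (auto simp: \<mu>'_def)
  next
    case (4 k)
    then show ?case using cert P by (auto simp: \<mu>'_def awgn_rate_powr)
  next
    case (5 k)
    \<comment> \<open>After cancelling \<open>(1 + P) * A\<close> this is
      \<open>1 + P \<le> A\<close> multiplied by \<open>\<sigma>2 - 1\<close>.\<close>
    have "(1 + P) * (A + \<sigma>2 - 1) \<le> A * (P + \<sigma>2)"
      using mult_right_mono[OF A, of "\<sigma>2 - 1"] \<sigma> by (simp add: algebra_simps)
    then have "1 \<le> w / (1 + P) * (P + \<sigma>2)"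
      using A P \<sigma> by (simp add: w_def le_divide_eq mult.commute)
    moreover have "1 + P + (\<sigma>2 - 1) = P + \<sigma>2" by simp
    ultimately have "1 \<le> w / (1 + P) * (1 + P + (\<sigma>2 - 1))" by (simp only:)
    then show ?case using 5 cert P by (cases "k < i") (auto simp: \<mu>'_def awgn_rate_powr)
  next
    case (6 k)
    then show ?case using cert by (auto simp: \<mu>'_def)
  next
    case (7 k)
    show ?case
    proof (cases "Suc k < i")
      case False
      show ?thesis
      proof (cases "Suc k = i")
        case True
        then show ?thesis using \<mu>0 by (auto simp: \<mu>'_def)
      next
        case F: False
        then have "i \<le> k" using False by simp
        then have "Suc k - i = Suc (k - i)" "Suc (k - i) < N'" using 7 by auto
        then show ?thesis using cert \<open>i \<le> k\<close> by (auto simp: \<mu>'_def)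
      qed
    qed (simp add: \<mu>'_def)
  next
    case (8 k)
    consider "Suc k < i" | "Suc k = i" | "i \<le> k" by linarith
    then show ?case
    proof cases
      case 1
      then show ?thesis by (simp add: \<mu>'_def)
    next
      case 2
      then show ?thesis using cum_energy_concat_before[of "Suc k"] P_eq by simp
    next
      case 3
      then have eq: "Suc k = i + Suc (k - i)" and less: "Suc (k - i) < N'" using 8 by auto
      have "\<mu> (Suc (k - i)) = \<mu> (k - i) \<or>
        cum_energy \<sigma>2 ?s' T' r1 r2 (Suc (k - i)) = (\<Sum>j<Suc (k - i). E (i + j))"
        using cert less by blast
      then show ?thesis
      proof
        assume "\<mu> (Suc (k - i)) = \<mu> (k - i)"
        then show ?thesis using 3 by (simp add: \<mu>'_def Suc_diff_le)
      next
        assume "cum_energy \<sigma>2 ?s' T' r1 r2 (Suc (k - i)) = (\<Sum>j<Suc (k - i). E (i + j))"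
        then have "cum_energy \<sigma>2 s (s i + T') ?r1 ?r2 (i + Suc (k - i)) = sum E {..<i + Suc (k - i)}"
          unfolding cum_energy_concat E_cum_shift P_eq by simp
        then show ?thesis unfolding eq[symmetric] ..
      qed
    qed
  next
    case 9
    have "cum_energy \<sigma>2 ?s' T' r1 r2 N' = (\<Sum>j<N'. E (i + j))" using cert by blast
    then show ?case unfolding cum_energy_concat E_cum_shift P_eq by simp
  qed
qed

end

end


section \<open>The steps of the algorithm\<close>

locale bc_problem = arrival_process s E for s E :: "nat \<Rightarrow> real" +
  fixes \<sigma>2 B1 B2 :: real
  assumes \<sigma>: "1 < \<sigma>2" and B1: "0 < B1" and B2: "0 < B2"
begin

lemma \<sigma>_ge: "1 \<le> \<sigma>2" and B2_ge: "0 \<le> B2"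
  using \<sigma> B2 by auto

lemma avg_power_0: "avg_power s E 0 j = sum E {..<j} / s j"
  by (simp add: avg_power_def s_0 lessThan_atLeast0)

lemma avg_power_0_pos: "0 < j \<Longrightarrow> 0 < avg_power s E 0 j"
  by (simp add: avg_power_0 s_pos E_cum_pos)

lemma step1_bounds:
  assumes "step1 \<sigma>2 s E B1 B2 i T"
  shows "0 < T" "T < s i" "0 < i" "const_energy \<sigma>2 B1 B2 T = sum E {..<i}"
proof -
  show "0 < T" "0 < i" "const_energy \<sigma>2 B1 B2 T = sum E {..<i}" using assms by (auto simp: step1_def)
  have "const_energy \<sigma>2 B1 B2 (s i) < const_energy \<sigma>2 B1 B2 T" using assms by (auto simp: step1_def)
  then show "T < s i"
    using const_energy_less_iff[OF \<sigma>_ge B1 B2_ge] \<open>0 < T\<close> s_pos[OF \<open>0 < i\<close>] by blast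
qed

lemma step1_minimal:
  assumes "step1 \<sigma>2 s E B1 B2 i T" "0 < j" "const_energy \<sigma>2 B1 B2 (s j) < sum E {..<j}"
  shows "i \<le> j"
proof (rule ccontr)
  assume "\<not> i \<le> j"
  then have "1 \<le> j \<and> j < i" using assms(2) by simp
  then show False using assms(1,3) unfolding step1_def by blast
qed

lemma constant_rates_optimal:
  assumes st: "step1 \<sigma>2 s E B1 B2 i T"
    and feas: "const_power_feasible s E T (1 / T * (\<Sum>j<i. E j))"
  shows "completes \<sigma>2 s E B1 B2 T (\<lambda>_. B1 / T) (\<lambda>_. B2 / T)"
    and "\<exists>\<mu>. cutoff_certificate \<sigma>2 s E T (\<lambda>_. B1 / T) (\<lambda>_. B2 / T) (B1 / T) \<mu>"
proof -
  note b = step1_bounds[OF st]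
  define P where "P = bc_power \<sigma>2 (B1 / T) (B2 / T)"
  have P: "P * T = sum E {..<i}" using b by (simp add: P_def const_energy_def)
  then have P': "1 / T * (\<Sum>j<i. E j) = P" using b by (simp add: field_simps)
  have cum: "cum_energy \<sigma>2 s T (\<lambda>_. B1 / T) (\<lambda>_. B2 / T) m = P * min (s m) T" if "m \<le> num_epochs s T" for m
    unfolding cum_energy_def P_def[symmetric]
    using that b by (simp add: sum_distrib_left[symmetric] sum_epoch_len_initial)
  have cum_le: "P * min (s m) T \<le> sum E {..<m}" if m: "m \<le> num_epochs s T" for m
  proof (cases "m = 0")
    case False
    define t where "t = min (s m) T"
    have t: "0 < t" "t \<le> T" using False b s_pos by (auto simp: t_def)
    have "P * t \<le> harvested s E t" using feas t unfolding const_power_feasible_def P' by auto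
    also have "\<dots> = sum E {..<num_epochs s t}" by (rule harvested_eq[OF t(1)])
    also have "\<dots> \<le> sum E {..<m}" using t by (intro E_cum_mono num_epochs_leI) (auto simp: t_def)
    finally show ?thesis by (simp add: t_def)
  qed (simp add: s_0 b less_imp_le)
  have causal: "energy_causal \<sigma>2 s E T (\<lambda>_. B1 / T) (\<lambda>_. B2 / T)"
    unfolding energy_causal_iff_cum[OF b(1) \<sigma>_ge] using b B1 B2 cum cum_le by auto
  then show "completes \<sigma>2 s E B1 B2 T (\<lambda>_. B1 / T) (\<lambda>_. B2 / T)"
    using b by (auto simp: completes_def delivered_eq sum_epoch_len sum_divide_distrib[symmetric] simp flip: sum_distrib_left)
  \<comment> \<open>\<open>T\<close> may lie before the last arrival counted by Step 1. The constant
    policy spends \<open>sum E {..<i}\<close> by \<open>T\<close>, and feasibility then forces the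
    arrivals before \<open>T\<close> to supply all of it.\<close>
  have "num_epochs s T \<le> i" using b by (intro num_epochs_leI) auto
  then have "sum E {..<num_epochs s T} \<le> sum E {..<i}" by (rule E_cum_mono)
  moreover have tight: "cum_energy \<sigma>2 s T (\<lambda>_. B1 / T) (\<lambda>_. B2 / T) (num_epochs s T) = sum E {..<i}"
    using cum[OF order_refl] P le_s_num_epochs[OF b(1)] by simp
  ultimately have fin: "cum_energy \<sigma>2 s T (\<lambda>_. B1 / T) (\<lambda>_. B2 / T) (num_epochs s T) = sum E {..<num_epochs s T}"
    using cum_le[OF order_refl] P le_s_num_epochs[OF b(1)] by simp
  define A C where "A = 2 powr (2 * (B1 / T))" and "C = 2 powr (2 * (B2 / T))"
  have AC: "2 powr (2 * (B1 / T + B2 / T)) = A * C" by (simp only: distrib_left powr_add A_def C_def)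
  have pos: "0 < A" "0 < C" by (auto simp: A_def C_def)
  have "A * C + (\<sigma>2 - 1) * C = (A + \<sigma>2 - 1) * C" by (simp add: algebra_simps)
  moreover have "0 < A + \<sigma>2 - 1" using pos \<sigma> by linarith
  ultimately have "cutoff_certificate \<sigma>2 s E T (\<lambda>_. B1 / T) (\<lambda>_. B2 / T) (B1 / T) (\<lambda>_. 1 / ((A + \<sigma>2 - 1) * C))"
    unfolding cutoff_certificate_def AC A_def[symmetric] C_def[symmetric]
    using fin pos b B1 by simp
  then show "\<exists>\<mu>. cutoff_certificate \<sigma>2 s E T (\<lambda>_. B1 / T) (\<lambda>_. B2 / T) (B1 / T) \<mu>" by blast
qed

text \<open>A violation at time \<open>t\<close> can be moved to the end of its epoch, where no more
  energy is available but the line is higher; that is a corner. Its index is below \<open>i\<close>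
  because up to \<open>T\<close> the line stays within \<open>sum E {..<i}\<close>. So Step 2 has a
  candidate, with slope below the tentative power.\<close>

lemma infeasible_corner:
  assumes st: "step1 \<sigma>2 s E B1 B2 i T"
    and infeas: "\<not> const_power_feasible s E T (1 / T * (\<Sum>j<i. E j))"
  obtains j where "0 < j" "j < i" "sum E {..<j} < sum E {..<i} / T * s j"
proof -
  note b = step1_bounds[OF st]
  define P where "P = sum E {..<i} / T"
  obtain t where t: "0 \<le> t" "t \<le> T" "harvested s E t < P * t"
    using infeas unfolding const_power_feasible_def P_def by (auto simp: not_le)
  have "t \<noteq> 0" using t by (auto simp: harvested_def no_arrivals_before_0)
  then have t0: "0 < t" using t by simp
  define j where "j = num_epochs s t"
  have H: "sum E {..<j} < P * t" using t harvested_eq[OF t0] by (simp add: j_def)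
  have P: "0 < P" using b E_cum_pos by (simp add: P_def)
  have "j < i"
  proof (rule ccontr)
    assume "\<not> j < i"
    then have "sum E {..<i} \<le> sum E {..<j}" by (intro E_cum_mono) simp
    moreover have "P * t \<le> P * T" using t P by simp
    moreover have "P * T = sum E {..<i}" using b by (simp add: P_def)
    ultimately show False using H by linarith
  qed
  moreover have j: "0 < j" unfolding j_def by (rule num_epochs_pos)
  moreover have "P * t \<le> P * s j" using P le_s_num_epochs[OF t0] by (simp add: j_def)
  then have "sum E {..<j} < P * s j" using H by linarith
  ultimately show ?thesis using that P_def by blast
qed

section \<open>Consequences of reaching Step 3\<close>

context
  fixes i1 :: nat
  assumes step3: "reaches_step3 \<sigma>2 s E B1 B2 i1"
begin

lemma step3E:
  obtains i T where "step1 \<sigma>2 s E B1 B2 i T" "0 < i1" "i1 < i"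
    "\<And>j. 0 < j \<Longrightarrow> j < i \<Longrightarrow> avg_power s E 0 i1 * s j \<le> sum E {..<j}"
    "avg_power s E 0 i1 < sum E {..<i} / T"
proof -
  obtain i T where st: "step1 \<sigma>2 s E B1 B2 i T"
    and infeas: "\<not> const_power_feasible s E T (1 / T * (\<Sum>j<i. E j))"
    and st2: "step2 s E i i1"
    using step3 unfolding reaches_step3_def by blast
  have i1: "0 < i1" "i1 < i" using st2 by (auto simp: step2_def is_arg_min_def)
  have min: "avg_power s E 0 i1 \<le> avg_power s E 0 j" if "0 < j" "j < i" for j
    using st2 that unfolding step2_def is_arg_min_def by (metis One_nat_def Suc_leI linorder_not_le)
  have le: "avg_power s E 0 i1 * s j \<le> sum E {..<j}" if "0 < j" "j < i" for j
    using min[OF that] s_pos[OF that(1)] by (simp add: avg_power_0[of j] le_divide_eq)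
  obtain j where j: "0 < j" "j < i" "sum E {..<j} < sum E {..<i} / T * s j"
    by (rule infeasible_corner[OF st infeas])
  have "avg_power s E 0 i1 * s j < sum E {..<i} / T * s j" using le[OF j(1,2)] j(3) by linarith
  then have "avg_power s E 0 i1 < sum E {..<i} / T" using s_pos[OF j(1)] by (simp only: mult_less_cancel_right_pos)
  then show ?thesis using that[OF st i1 le] by simp
qed

abbreviation "P1 \<equiv> avg_power s E 0 i1"

lemma i1_pos: "0 < i1"
  using step3E by blast

lemma P1_pos: "0 < P1"
  by (rule avg_power_0_pos[OF i1_pos])

lemma P1_eq: "P1 * s i1 = sum E {..<i1}"
  using s_pos[OF i1_pos] by (simp add: avg_power_0)

lemma P1_le:
  assumes "m \<le> i1"
  shows "P1 * s m \<le> sum E {..<m}"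
proof (cases "m = 0")
  case False
  obtain i where "i1 < i" "\<And>j. 0 < j \<Longrightarrow> j < i \<Longrightarrow> P1 * s j \<le> sum E {..<j}"
    using step3E by blast
  then show ?thesis using assms False by simp
qed (simp add: s_0)

text \<open>The continuation must again start with positive energy. Were \<open>E i1\<close> zero,
  the next corner would have equal height and a smaller slope, against the choice of
  \<open>i1\<close>. If that corner is no candidate, then \<open>i = Suc i1\<close> and Step 1
  failing at \<open>i1\<close> gives \<open>s i1 \<le> T\<close>; the tentative power would then be
  at most \<open>P1\<close>, which it strictly exceeds.\<close>

lemma E_i1_pos: "0 < E i1"
proof -
  obtain i T where st: "step1 \<sigma>2 s E B1 B2 i T" and i1: "0 < i1" "i1 < i"
    and le: "\<And>j. 0 < j \<Longrightarrow> j < i \<Longrightarrow> P1 * s j \<le> sum E {..<j}" and less: "P1 < sum E {..<i} / T"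
    using step3E by blast
  note b = step1_bounds[OF st]
  show ?thesis
  proof (rule ccontr)
    assume "\<not> 0 < E i1"
    then have "E i1 = 0" using E_nonneg[of i1] by simp
    then have H: "sum E {..<Suc i1} = sum E {..<i1}" by simp
    show False
    proof (cases "Suc i1 < i")
      case True
      then have "P1 * s (Suc i1) \<le> P1 * s i1" using le[of "Suc i1"] H P1_eq by simp
      then show False using P1_pos by simp
    next
      case False
      then have "i = Suc i1" using i1 by simp
      then have eq: "sum E {..<i} = P1 * s i1" using H P1_eq by simp
      have "\<not> const_energy \<sigma>2 B1 B2 (s i1) < sum E {..<i1}"
        using step1_minimal[OF st i1(1)] i1 by auto
      then have "\<not> const_energy \<sigma>2 B1 B2 (s i1) < const_energy \<sigma>2 B1 B2 T"
        using b eq P1_eq by simp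
      then have "s i1 \<le> T"
        using const_energy_less_iff[OF \<sigma>_ge B1 B2_ge b(1) s_pos[OF i1(1)]] by simp
      then have "P1 * s i1 / T \<le> P1" using P1_pos b by (simp add: divide_le_eq)
      then show False using less eq by simp
    qed
  qed
qed

text \<open>The line of slope \<open>p\<close> stays below the harvested energy up to the deadline
  it induces. Below \<open>i\<close> the choice of \<open>i1\<close> gives this; from
  \<open>i\<close> on it suffices that \<open>p * T\<close> is at most the energy of Step 1.\<close>

lemma knot_ge:
  assumes p: "0 < p" "p \<le> P1" and T_eq: "T = B1 / awgn_rate p" and j: "0 < j" "j \<le> num_epochs s T"
  shows "p * knot s T j \<le> sum E {..<j}"
proof -
  obtain i Tt where st: "step1 \<sigma>2 s E B1 B2 i Tt"
    and le: "\<And>j. 0 < j \<Longrightarrow> j < i \<Longrightarrow> P1 * s j \<le> sum E {..<j}" and less: "P1 < sum E {..<i} / Tt"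
    using step3E by blast
  note b = step1_bounds[OF st]
  have T: "0 < T" using B1 p by (simp add: T_eq awgn_rate_pos)
  have B1_eq: "B1 = awgn_rate p * T" using awgn_rate_pos[OF p(1)] by (simp add: T_eq)
  have knot: "knot s T j = min (s j) T" using knot_eq[OF T j(2)] .
  show ?thesis
  proof (cases "j < i")
    case True
    have "p * knot s T j \<le> P1 * s j" using p s_nonneg knot T by (intro mult_mono) auto
    then show ?thesis using le[OF j(1) True] by linarith
  next
    case False
    then have H: "sum E {..<i} \<le> sum E {..<j}" by (intro E_cum_mono) simp
    have "p * knot s T j \<le> p * T" using p knot by simp
    \<comment> \<open>If \<open>T\<close> is past the tentative time, serving user 1 alone by
      \<open>T\<close> costs \<open>p * T\<close>, no more than serving both users by the earlier
      time. Otherwise \<open>p\<close> is below the tentative power.\<close>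
    also have "p * T \<le> sum E {..<i}"
    proof (cases "Tt \<le> T")
      case True
      have "p * T \<le> const_energy \<sigma>2 B1 B2 T"
        using p by (intro const_energy_ge_user1[OF \<sigma>_ge T B2_ge _ B1_eq]) auto
      also have "\<dots> \<le> const_energy \<sigma>2 B1 B2 Tt"
        by (rule const_energy_antimono[OF \<sigma>_ge B1 B2_ge b(1) True])
      finally show ?thesis using b by simp
    next
      case False
      then have "p * T \<le> sum E {..<i} / Tt * Tt" using p less T b by (intro mult_mono) auto
      then show ?thesis using b by simp
    qed
    finally show ?thesis using H by simp
  qed
qed

lemma total_power_ge_cutoff:
  assumes "0 < p" "p \<le> P1" "T = B1 / awgn_rate p" "k < num_epochs s T"
  shows "p \<le> total_power s E T k"
  using assms B1 by (intro total_power_ge) (auto simp: awgn_rate_pos intro!: knot_ge)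

text \<open>The continuation problem of Step 3b can be completed by the tentative time \<open>T1\<close>;
  this is what forces its cut-off power to be at least \<open>P1\<close>.\<close>
context
  assumes excess: "B2 < bits2 \<sigma>2 s E (B1 / awgn_rate P1) P1"
begin

abbreviation "T1 \<equiv> B1 / awgn_rate P1"

lemma T1_pos: "0 < T1"
  using B1 awgn_rate_pos[OF P1_pos] by simp

lemmas T1_policy = cutoff_policy[OF \<sigma> T1_pos P1_pos total_power_ge_cutoff[OF P1_pos order_refl refl]]

lemma T1_completes:
  "completes \<sigma>2 s E B1 (bits2 \<sigma>2 s E T1 P1) T1 (\<lambda>_. awgn_rate P1) (\<lambda>k. user2_rate \<sigma>2 (total_power s E T1 k) P1)"
  using T1_policy(2,3,4) T1_pos awgn_rate_pos[OF P1_pos] by (simp add: completes_def)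

lemma const_energy_T1: "const_energy \<sigma>2 B1 B2 T1 < sum E {..<num_epochs s T1}"
  using const_energy_strict_mono2[OF \<sigma>_ge excess T1_pos, of B1]
    completes_const_energy[OF \<sigma>_ge T1_completes B1] by linarith

text \<open>Rounding \<open>T1\<close> up to an arrival only lowers the energy for constant rates,
  so the test of Step 1 succeeds there. Hence the chosen corner precedes \<open>T1\<close>.\<close>

lemma step1_le_num_epochs_T1:
  assumes "step1 \<sigma>2 s E B1 B2 i T"
  shows "i \<le> num_epochs s T1"
proof (rule step1_minimal[OF assms num_epochs_pos])
  show "const_energy \<sigma>2 B1 B2 (s (num_epochs s T1)) < sum E {..<num_epochs s T1}"
    using const_energy_antimono[OF \<sigma>_ge B1 B2_ge T1_pos le_s_num_epochs[OF T1_pos]] const_energy_T1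
    by linarith
qed

lemma i1_less: "i1 < num_epochs s T1"
  using step3E step1_le_num_epochs_T1 order_less_le_trans by metis

lemma s_i1_less: "s i1 < T1"
  using i1_less less_num_epochs_iff[OF T1_pos] by simp

text \<open>Every epoch has power at least \<open>P1\<close>, yet causality at \<open>i1\<close>
  allows only the energy \<open>P1 * s i1\<close>. So the tentative policy gives user 2 nothing
  before \<open>s i1\<close>, and all its bits for user 2 fall into the continuation.\<close>

lemma total_power_initial:
  assumes "k < i1"
  shows "total_power s E T1 k = P1"
proof (rule ccontr)
  assume ne: "total_power s E T1 k \<noteq> P1"
  have ge: "P1 \<le> total_power s E T1 j" if "j < i1" for j
    using total_power_ge_cutoff[OF P1_pos order_refl refl] that i1_less by simp
  have "(\<Sum>j<i1. P1 * epoch_len s T1 j) < (\<Sum>j<i1. total_power s E T1 j * epoch_len s T1 j)"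
  proof (rule sum_strict_mono_ex1)
    show "\<forall>j\<in>{..<i1}. P1 * epoch_len s T1 j \<le> total_power s E T1 j * epoch_len s T1 j"
      using ge by (auto intro: mult_right_mono)
    show "\<exists>j\<in>{..<i1}. P1 * epoch_len s T1 j < total_power s E T1 j * epoch_len s T1 j"
      using ge[OF assms] ne assms epoch_len_pos[OF T1_pos, of k] i1_less
      by (intro bexI[of _ k] mult_strict_right_mono) auto
  qed simp
  also have "\<dots> \<le> sum E {..<i1}" using cum_total_power_le[OF T1_pos] i1_less by simp
  finally show False
    using P1_eq i1_less s_i1_less
    by (simp add: sum_distrib_left[symmetric] sum_epoch_len_initial[OF T1_pos])
qed

lemma continuation_bits: "B1 - awgn_rate P1 * s i1 = awgn_rate P1 * (T1 - s i1)"
  using awgn_rate_pos[OF P1_pos] by (simp add: right_diff_distrib)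

lemma continuation_problem:
  "bc_problem (\<lambda>k. s (i1 + k) - s i1) (\<lambda>k. E (i1 + k)) \<sigma>2 (B1 - awgn_rate P1 * s i1) B2"
proof -
  interpret sub: arrival_process "\<lambda>k. s (i1 + k) - s i1" "\<lambda>k. E (i1 + k)"
    by (rule arrival_process_shift[OF E_i1_pos])
  show ?thesis
  proof
    show "0 < B1 - awgn_rate P1 * s i1"
      unfolding continuation_bits using awgn_rate_pos[OF P1_pos] s_i1_less by simp
  qed (use \<sigma> B2 in auto)
qed

lemma continuation_completes_excess:
  "completes \<sigma>2 (\<lambda>k. s (i1 + k) - s i1) (\<lambda>k. E (i1 + k)) (B1 - awgn_rate P1 * s i1)
     (bits2 \<sigma>2 s E T1 P1) (T1 - s i1)
     (\<lambda>_. awgn_rate P1) (\<lambda>k. user2_rate \<sigma>2 (total_power s E T1 (i1 + k)) P1)"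
proof -
  interpret sub: arrival_process "\<lambda>k. s (i1 + k) - s i1" "\<lambda>k. E (i1 + k)"
    by (rule arrival_process_shift[OF E_i1_pos])
  let ?r2 = "\<lambda>k. user2_rate \<sigma>2 (total_power s E T1 k) P1"
  have T': "0 < T1 - s i1" using s_i1_less by simp
  have T1_eq: "s i1 + (T1 - s i1) = T1" by simp
  have N: "num_epochs s T1 = i1 + num_epochs (\<lambda>k. s (i1 + k) - s i1) (T1 - s i1)"
    using num_epochs_shift[of i1 "T1 - s i1", OF E_i1_pos T'] by simp
  have r1: "(\<lambda>k. if k < i1 then awgn_rate P1 else awgn_rate P1) = (\<lambda>_. awgn_rate P1)" by simp
  have len: "epoch_len (\<lambda>k. s (i1 + k) - s i1) (T1 - s i1) k = epoch_len s T1 (i1 + k)" for k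
    using epoch_len_shift[of s i1 "T1 - s i1" k] by simp
  have cum: "cum_energy \<sigma>2 (\<lambda>k. s (i1 + k) - s i1) (T1 - s i1) (\<lambda>_. awgn_rate P1) (\<lambda>k. ?r2 (i1 + k)) m
    = cum_energy \<sigma>2 s T1 (\<lambda>_. awgn_rate P1) ?r2 (i1 + m) - cum_energy \<sigma>2 s T1 (\<lambda>_. awgn_rate P1) ?r2 i1" for m
    unfolding cum_energy_def sum_lessThan_add len by simp
  have initial: "cum_energy \<sigma>2 s T1 (\<lambda>_. awgn_rate P1) ?r2 i1 = sum E {..<i1}"
  proof -
    have "cum_energy \<sigma>2 s T1 (\<lambda>_. awgn_rate P1) ?r2 i1 = (\<Sum>k<i1. P1 * epoch_len s T1 k)"
      using i1_less by (simp add: T1_policy(1) total_power_initial)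
    also have "\<dots> = P1 * s i1"
      using i1_less s_i1_less by (simp add: sum_distrib_left[symmetric] sum_epoch_len_initial[OF T1_pos])
    finally show ?thesis using P1_eq by simp
  qed
  have causal: "\<forall>k<num_epochs s T1. 0 \<le> awgn_rate P1 \<and> 0 \<le> ?r2 k"
    "\<And>m. m \<le> num_epochs s T1 \<Longrightarrow> cum_energy \<sigma>2 s T1 (\<lambda>_. awgn_rate P1) ?r2 m \<le> sum E {..<m}"
    using T1_policy(2) unfolding energy_causal_iff_cum[OF T1_pos \<sigma>_ge] by auto
  have "energy_causal \<sigma>2 (\<lambda>k. s (i1 + k) - s i1) (\<lambda>k. E (i1 + k)) (T1 - s i1)
      (\<lambda>_. awgn_rate P1) (\<lambda>k. ?r2 (i1 + k))"
    unfolding sub.energy_causal_iff_cum[OF T' \<sigma>_ge] cum initial E_cum_shift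
    using causal N P1_pos by (auto simp: awgn_rate_nonneg)
  moreover have "delivered (\<lambda>k. s (i1 + k) - s i1) (\<lambda>_. awgn_rate P1) (T1 - s i1) = B1 - awgn_rate P1 * s i1"
    unfolding sub.delivered_eq[OF T'] continuation_bits
    by (simp only: sum_distrib_left[symmetric] sub.sum_epoch_len[OF T'])
  moreover have "delivered (\<lambda>k. s (i1 + k) - s i1) (\<lambda>k. ?r2 (i1 + k)) (T1 - s i1) = bits2 \<sigma>2 s E T1 P1"
  proof -
    have "(\<Sum>k<i1. ?r2 k * epoch_len s T1 k) = 0"
      by (simp add: total_power_initial user2_rate_def)
    then show ?thesis
      unfolding sub.delivered_eq[OF T'] bits2_eq[OF T1_pos] N sum_lessThan_add len by simp
  qed
  ultimately show ?thesis using T' by (simp add: completes_def)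
qed

lemma continuation_completes:
  "\<exists>r2. completes \<sigma>2 (\<lambda>k. s (i1 + k) - s i1) (\<lambda>k. E (i1 + k)) (B1 - awgn_rate P1 * s i1)
     B2 (T1 - s i1) (\<lambda>_. awgn_rate P1) r2"
proof -
  interpret sub: bc_problem "\<lambda>k. s (i1 + k) - s i1" "\<lambda>k. E (i1 + k)" \<sigma>2 "B1 - awgn_rate P1 * s i1" B2
    by (rule continuation_problem)
  show ?thesis
    using sub.completes_fewer_bits[OF \<sigma>_ge continuation_completes_excess _ B2_ge] s_i1_less excess by auto
qed

text \<open>The line of slope \<open>P1\<close> from the origin touches the corner at
  \<open>i1\<close> and stays below all corners before \<open>T1\<close>, so slopes measured from
  \<open>i1\<close> to those corners are at least \<open>P1\<close>. The next corner is one of them.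
  This serves both termination and the price at the junction.\<close>

lemma continuation_power_ge:
  assumes sub3: "reaches_step3 \<sigma>2 (\<lambda>k. s (i1 + k) - s i1) (\<lambda>k. E (i1 + k)) (B1 - awgn_rate P1 * s i1) B2 j"
  shows "P1 \<le> avg_power (\<lambda>k. s (i1 + k) - s i1) (\<lambda>k. E (i1 + k)) 0 j"
proof -
  interpret sub: bc_problem "\<lambda>k. s (i1 + k) - s i1" "\<lambda>k. E (i1 + k)" \<sigma>2 "B1 - awgn_rate P1 * s i1" B2
    by (rule continuation_problem)
  let ?s = "\<lambda>k. s (i1 + k) - s i1" and ?B1 = "B1 - awgn_rate P1 * s i1"
  have T': "0 < T1 - s i1" using s_i1_less by simp
  define N' where "N' = num_epochs ?s (T1 - s i1)"
  have "const_energy \<sigma>2 ?B1 B2 (T1 - s i1) < const_energy \<sigma>2 ?B1 (bits2 \<sigma>2 s E T1 P1) (T1 - s i1)"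
    by (rule const_energy_strict_mono2[OF \<sigma>_ge excess T'])
  also have "\<dots> \<le> (\<Sum>k<N'. E (i1 + k))"
    unfolding N'_def by (rule sub.completes_const_energy[OF \<sigma>_ge continuation_completes_excess sub.B1])
  finally have "const_energy \<sigma>2 ?B1 B2 (T1 - s i1) < (\<Sum>k<N'. E (i1 + k))" .
  moreover have "const_energy \<sigma>2 ?B1 B2 (?s N') \<le> const_energy \<sigma>2 ?B1 B2 (T1 - s i1)"
    unfolding N'_def by (rule const_energy_antimono[OF \<sigma>_ge sub.B1 B2_ge T' sub.le_s_num_epochs[OF T']])
  ultimately have N': "const_energy \<sigma>2 ?B1 B2 (?s N') < (\<Sum>k<N'. E (i1 + k))" by linarith
  obtain i T where st: "step1 \<sigma>2 ?s (\<lambda>k. E (i1 + k)) ?B1 B2 i T" and j: "0 < j" "j < i"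
    using sub.step3E[OF sub3] by blast
  have "0 < N'" unfolding N'_def by (rule sub.num_epochs_pos)
  \<comment> \<open>The tail of the tentative policy makes the test of Step 1 succeed for the
    continuation by the epoch of \<open>T1\<close>; this places corner \<open>j\<close> before
    \<open>T1\<close>.\<close>
  then have "i \<le> N'" by (rule sub.step1_minimal[OF st _ N'])
  then have "?s j < T1 - s i1" using j sub.less_num_epochs_iff[OF T', of j] by (simp add: N'_def)
  then have less: "s (i1 + j) < T1" by simp
  then have n: "i1 + j < num_epochs s T1" using less_num_epochs_iff[OF T1_pos] by simp
  have "P1 * knot s T1 (i1 + j) \<le> sum E {..<i1 + j}"
    using knot_ge[OF P1_pos order_refl refl _ less_imp_le[OF n]] j by simp
  moreover have "knot s T1 (i1 + j) = s (i1 + j)" using n less by (simp add: knot_eq[OF T1_pos])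
  ultimately have "P1 * ?s j \<le> (\<Sum>k<j. E (i1 + k))"
    unfolding E_cum_shift using P1_eq by (simp add: right_diff_distrib)
  then show ?thesis using sub.s_pos[OF j(1)] by (simp add: sub.avg_power_0 le_divide_eq)
qed

end

end

end


section \<open>Existence of the cut-off power\<close>

lemma log_rate_tangent:
  assumes "0 < \<sigma>2" "0 \<le> x" "0 \<le> y"
  shows "1 / 2 * log 2 (x + \<sigma>2) \<le> 1 / 2 * log 2 (y + \<sigma>2) + (x - y) / (2 * ln 2 * (y + \<sigma>2))"
proof -
  have pos: "0 < x + \<sigma>2" "0 < y + \<sigma>2" using assms by auto
  have "ln ((x + \<sigma>2) / (y + \<sigma>2)) \<le> (x + \<sigma>2) / (y + \<sigma>2) - 1"
    using pos by (intro ln_le_minus_one) simp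
  also have "\<dots> = (x - y) / (y + \<sigma>2)" using pos by (simp add: field_simps)
  finally have "ln (x + \<sigma>2) - ln (y + \<sigma>2) \<le> (x - y) / (y + \<sigma>2)" using pos by (simp add: ln_div)
  then have "(ln (x + \<sigma>2) - ln (y + \<sigma>2)) / (2 * ln 2) \<le> (x - y) / (y + \<sigma>2) / (2 * ln 2)"
    by (intro divide_right_mono) auto
  then show ?thesis by (simp add: log_def diff_divide_distrib mult.commute)
qed

section \<open>The taut string as a maximiser and its continuity in the deadline\<close>

context arrival_process
begin

text \<open>The duality argument again, now for a concave integrand of the power alone. The schedule
  \<open>Q\<close> on \<open>[0, T')\<close> is continued with zero power up to \<open>T\<close>,
  which accounts for the term with \<open>log 2 \<sigma>2\<close>.\<close>

lemma string_value_max: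
  assumes \<sigma>: "0 < \<sigma>2" and T': "0 < T'" "T' \<le> T"
    and Q: "\<And>k. k < num_epochs s T' \<Longrightarrow> 0 \<le> Q k"
    and cum: "\<And>m. m \<le> num_epochs s T' \<Longrightarrow> (\<Sum>k<m. Q k * epoch_len s T' k) \<le> sum E {..<m}"
  shows "(\<Sum>k<num_epochs s T'. 1 / 2 * log 2 (Q k + \<sigma>2) * epoch_len s T' k) + 1 / 2 * log 2 \<sigma>2 * (T - T')
    \<le> string_value \<sigma>2 s E T"
proof -
  have T: "0 < T" using T' by simp
  define N where "N = num_epochs s T"
  define l l' where "l = epoch_len s T" and "l' = epoch_len s T'"
  define p where "p = total_power s E T"
  define \<psi> where "\<psi> x = 1 / 2 * log 2 (x + \<sigma>2)" for x
  \<comment> \<open>The derivative of \<open>\<psi>\<close> at the power of the string: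
    nonincreasing, and changing only where all energy is spent.\<close>
  define \<mu> where "\<mu> k = 1 / (2 * ln 2 * (p k + \<sigma>2))" for k
  have N': "num_epochs s T' \<le> N" unfolding N_def using num_epochs_mono T' by simp
  have l': "0 \<le> l' k" "l' k \<le> l k" for k
    using epoch_len_mono[of T' T s k] T' by (auto simp: l_def l'_def)
  have p: "0 \<le> p k" if "k < N" for k
    using total_power_nonneg[OF T] that by (simp add: p_def N_def)
  have step: "\<psi> (Q k) * l' k + \<psi> 0 * (l k - l' k) \<le> \<psi> (p k) * l k + \<mu> k * (Q k * l' k - p k * l k)"
    if k: "k < N" for k
  proof -
    have "\<psi> (Q k) * l' k \<le> (\<psi> (p k) + (Q k - p k) / (2 * ln 2 * (p k + \<sigma>2))) * l' k"
    proof (cases "k < num_epochs s T'")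
      case True
      then show ?thesis
        unfolding \<psi>_def using log_rate_tangent[OF \<sigma> Q[OF True] p[OF k]] l' by (intro mult_right_mono)
    next
      case False
      then have "l' k = 0" by (simp add: l'_def epoch_len_0 T')
      then show ?thesis by simp
    qed
    moreover have "\<psi> 0 * (l k - l' k) \<le> (\<psi> (p k) + (0 - p k) / (2 * ln 2 * (p k + \<sigma>2))) * (l k - l' k)"
      unfolding \<psi>_def using log_rate_tangent[OF \<sigma> order_refl p[OF k]] l' by (intro mult_right_mono) auto
    ultimately have "\<psi> (Q k) * l' k + \<psi> 0 * (l k - l' k) \<le>
      (\<psi> (p k) + \<mu> k * (Q k - p k)) * l' k + (\<psi> (p k) + \<mu> k * (0 - p k)) * (l k - l' k)"
      unfolding \<mu>_def by simp
    also have "\<dots> = \<psi> (p k) * l k + \<mu> k * (Q k * l' k - p k * l k)" by (simp add: algebra_simps)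
    finally show ?thesis .
  qed
  have "(\<Sum>k<N. \<mu> k * (Q k * l' k - p k * l k)) \<le> 0"
  proof (rule sum_mult_nonpos_Abel)
    have D: "(\<Sum>j<m. Q j * l' j - p j * l j) \<le> sum E {..<m} - (\<Sum>j<m. p j * l j)" for m
      using cum_le_extend[OF T'(1) cum, of m] by (simp add: sum_subtractf l'_def)
    show "0 \<le> \<mu> k" if "k < N" for k using p[OF that] \<sigma> by (simp add: \<mu>_def)
    show "\<mu> (Suc k) \<le> \<mu> k" if "Suc k < N" for k
      unfolding \<mu>_def using that total_power_Suc(1)[OF T, of k] p[of k] \<sigma>
      by (intro divide_left_mono mult_left_mono mult_pos_pos add_right_mono) (auto simp: N_def p_def)
    show "(\<Sum>j<Suc k. Q j * l' j - p j * l j) \<le> 0" if "Suc k < N" "\<mu> (Suc k) \<noteq> \<mu> k" for k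
    proof -
      have "p (Suc k) \<noteq> p k" using that by (auto simp: \<mu>_def)
      then have "(\<Sum>j<Suc k. p j * l j) = sum E {..<Suc k}"
        using total_power_Suc(2)[OF T, of k] that unfolding p_def l_def N_def by blast
      then show ?thesis using D[of "Suc k"] by linarith
    qed
    show "(\<Sum>j<N. Q j * l' j - p j * l j) \<le> 0"
      using D[of N] cum_total_power[OF T] by (simp add: p_def l_def N_def)
  qed
  moreover have "(\<Sum>k<N. \<psi> (Q k) * l' k + \<psi> 0 * (l k - l' k)) \<le>
      (\<Sum>k<N. \<psi> (p k) * l k + \<mu> k * (Q k * l' k - p k * l k))"
    using step by (intro sum_mono) auto
  moreover have "(\<Sum>k<N. l k) = T" using sum_epoch_len[OF T] by (simp add: l_def N_def)
  moreover have "(\<Sum>k<N. l' k) = T'"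
    using sum_epoch_len[OF T'(1)] sum_epoch_len_extend[OF T'(1) N', where f = "\<lambda>_. 1"] by (simp add: l'_def)
  moreover have "(\<Sum>k<num_epochs s T'. \<psi> (Q k) * l' k) = (\<Sum>k<N. \<psi> (Q k) * l' k)"
    unfolding l'_def by (rule sum_epoch_len_extend[OF T'(1) N'])
  moreover have "string_value \<sigma>2 s E T = (\<Sum>k<N. \<psi> (p k) * l k)"
    by (simp add: string_value_def \<psi>_def p_def l_def N_def)
  ultimately have "(\<Sum>k<num_epochs s T'. \<psi> (Q k) * l' k) + \<psi> 0 * (T - T') \<le> string_value \<sigma>2 s E T"
    by (simp add: sum.distrib sum_subtractf sum_distrib_left[symmetric] del: times_divide_eq_left times_divide_eq_right)
  then show ?thesis by (simp add: \<psi>_def l'_def)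
qed

lemma string_value_mono:
  assumes \<sigma>: "1 < \<sigma>2" and T': "0 < T'" "T' \<le> T"
  shows "string_value \<sigma>2 s E T' \<le> string_value \<sigma>2 s E T"
proof -
  have "string_value \<sigma>2 s E T' + 1 / 2 * log 2 \<sigma>2 * (T - T') \<le> string_value \<sigma>2 s E T"
    unfolding string_value_def[of \<sigma>2 s E T'] using \<sigma> T'
    by (intro string_value_max) (auto simp: total_power_nonneg cum_total_power_le)
  moreover have "0 \<le> 1 / 2 * log 2 \<sigma>2 * (T - T')" using \<sigma> T' by simp
  ultimately show ?thesis by linarith
qed

text \<open>Cutting the optimal schedule for \<open>T\<close> down to \<open>T'\<close> loses
  \<open>\<psi> (p k)\<close> per unit of lost time, and \<open>p k\<close> has no uniform bound.
  The tangent at \<open>a\<close> splits the loss into a part proportional to \<open>T - T'\<close>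
  and a part bounded by the total energy over \<open>a\<close>, however large the powers are;
  \<open>a\<close> remains free.\<close>

lemma string_value_increment:
  assumes \<sigma>: "1 < \<sigma>2" and T': "0 < T'" "T' \<le> T" and a: "0 < a"
  shows "string_value \<sigma>2 s E T - string_value \<sigma>2 s E T'
    \<le> (T - T') * (1 / 2 * log 2 (a + \<sigma>2)) + sum E {..<num_epochs s T} / (2 * ln 2 * a)"
proof -
  have T: "0 < T" using T' by simp
  define N where "N = num_epochs s T"
  define l l' where "l = epoch_len s T" and "l' = epoch_len s T'"
  define p where "p = total_power s E T"
  define \<psi> where "\<psi> x = 1 / 2 * log 2 (x + \<sigma>2)" for x
  have N': "num_epochs s T' \<le> N" unfolding N_def using num_epochs_mono T' by simp
  have l': "0 \<le> l' k" "l' k \<le> l k" for k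
    using epoch_len_mono[of T' T s k] T' by (auto simp: l_def l'_def)
  have p: "0 \<le> p k" if "k < N" for k
    using total_power_nonneg[OF T] that by (simp add: p_def N_def)
  have "(\<Sum>k<num_epochs s T'. \<psi> (p k) * l' k) + \<psi> 0 * (T' - T') \<le> string_value \<sigma>2 s E T'"
    unfolding \<psi>_def l'_def add_0
  proof (rule string_value_max)
    fix m assume m: "m \<le> num_epochs s T'"
    have "(\<Sum>k<m. p k * epoch_len s T' k) \<le> (\<Sum>k<m. p k * l k)"
      using p l' m N' by (intro sum_mono mult_left_mono) (auto simp: l'_def)
    also have "\<dots> \<le> sum E {..<m}"
      using cum_total_power_le[OF T, of m] m N' by (simp add: p_def l_def N_def)
    finally show "(\<Sum>k<m. p k * epoch_len s T' k) \<le> sum E {..<m}" .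
  qed (use \<sigma> T' p N' in auto)
  moreover have "(\<Sum>k<num_epochs s T'. \<psi> (p k) * l' k) = (\<Sum>k<N. \<psi> (p k) * l' k)"
    unfolding l'_def by (rule sum_epoch_len_extend[OF T'(1) N'])
  moreover have "string_value \<sigma>2 s E T = (\<Sum>k<N. \<psi> (p k) * l k)"
    by (simp add: string_value_def \<psi>_def p_def l_def N_def)
  ultimately have "string_value \<sigma>2 s E T - string_value \<sigma>2 s E T' \<le> (\<Sum>k<N. \<psi> (p k) * (l k - l' k))"
    by (simp add: right_diff_distrib sum_subtractf)
  also have "\<dots> \<le> (\<Sum>k<N. \<psi> a * (l k - l' k) + p k * l k * (1 / (2 * ln 2 * a)))"
  proof (rule sum_mono)
    fix k assume "k \<in> {..<N}"
    then have pk: "0 \<le> p k" using p by simp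
    have "\<psi> (p k) \<le> \<psi> a + (p k - a) / (2 * ln 2 * (a + \<sigma>2))"
      unfolding \<psi>_def using \<sigma> a pk by (intro log_rate_tangent) auto
    also have "(p k - a) / (2 * ln 2 * (a + \<sigma>2)) \<le> p k / (2 * ln 2 * (a + \<sigma>2))"
      using a \<sigma> by (intro divide_right_mono) auto
    also have "\<dots> \<le> p k / (2 * ln 2 * a)" using a \<sigma> pk by (intro divide_left_mono mult_left_mono) auto
    finally have "\<psi> (p k) * (l k - l' k) \<le> (\<psi> a + p k / (2 * ln 2 * a)) * (l k - l' k)"
      using l' by (intro mult_right_mono) auto
    also have "\<dots> = \<psi> a * (l k - l' k) + p k / (2 * ln 2 * a) * (l k - l' k)" by (simp add: algebra_simps)
    also have "p k / (2 * ln 2 * a) * (l k - l' k) \<le> p k / (2 * ln 2 * a) * l k"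
      using a pk l' by (intro mult_left_mono) auto
    finally show "\<psi> (p k) * (l k - l' k) \<le> \<psi> a * (l k - l' k) + p k * l k * (1 / (2 * ln 2 * a))"
      by simp
  qed
  also have "\<dots> = \<psi> a * (T - T') + sum E {..<N} / (2 * ln 2 * a)"
  proof -
    have "(\<Sum>k<N. l k) = T" using sum_epoch_len[OF T] by (simp add: l_def N_def)
    moreover have "(\<Sum>k<N. l' k) = T'"
      using sum_epoch_len[OF T'(1)] sum_epoch_len_extend[OF T'(1) N', where f = "\<lambda>_. 1"] by (simp add: l'_def)
    moreover have "(\<Sum>k<N. p k * l k) = sum E {..<N}"
      using cum_total_power[OF T] by (simp add: p_def l_def N_def)
    ultimately show ?thesis
      unfolding sum.distrib sum_distrib_left[symmetric] sum_distrib_right[symmetric] sum_subtractf by simp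
  qed
  finally show ?thesis by (simp add: \<psi>_def N_def mult.commute)
qed

lemma continuous_on_string_value:
  assumes \<sigma>: "1 < \<sigma>2"
  shows "continuous_on {0<..M} (string_value \<sigma>2 s E)"
  unfolding continuous_on_def
proof (intro ballI tendstoI)
  fix x \<epsilon> :: real
  assume x: "x \<in> {0<..M}" and \<epsilon>: "0 < \<epsilon>"
  define C where "C = sum E {..<num_epochs s M}"
  have C: "0 < C" unfolding C_def by (intro E_cum_pos num_epochs_pos)
  \<comment> \<open>Makes the energy term of the increment bound equal to
    \<open>\<epsilon> / 2\<close> for all deadlines up to \<open>M\<close>.\<close>
  define a where "a = C / (\<epsilon> * ln 2)"
  have a: "0 < a" using C \<epsilon> by (simp add: a_def)
  have Ca: "C / (2 * ln 2 * a) = \<epsilon> / 2" using C \<epsilon> by (simp add: a_def)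
  define b where "b = 1 / 2 * log 2 (a + \<sigma>2)"
  have b: "0 < b" using a \<sigma> by (simp add: b_def)
  have close: "\<bar>string_value \<sigma>2 s E t - string_value \<sigma>2 s E u\<bar> \<le> (t - u) * b + \<epsilon> / 2"
    if "0 < u" "u \<le> t" "t \<le> M" for t u
  proof -
    have "sum E {..<num_epochs s t} / (2 * ln 2 * a) \<le> C / (2 * ln 2 * a)"
      unfolding C_def using that a by (intro divide_right_mono E_cum_mono num_epochs_mono) auto
    then show ?thesis
      using string_value_increment[OF \<sigma> that(1,2) a] string_value_mono[OF \<sigma> that(1,2)]
      unfolding b_def[symmetric] Ca by linarith
  qed
  show "\<forall>\<^sub>F y in at x within {0<..M}. dist (string_value \<sigma>2 s E y) (string_value \<sigma>2 s E x) < \<epsilon>"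
    unfolding eventually_at
  proof (intro exI conjI ballI impI)
    show "0 < \<epsilon> / (2 * b)" using \<epsilon> b by simp
    fix y assume "y \<in> {0<..M}" "y \<noteq> x \<and> dist y x < \<epsilon> / (2 * b)"
    then have y: "y \<in> {0<..M}" "dist y x < \<epsilon> / (2 * b)" by auto
    have "\<bar>y - x\<bar> * b < \<epsilon> / 2" using y(2) b by (simp add: dist_real_def field_simps)
    moreover have "\<bar>string_value \<sigma>2 s E y - string_value \<sigma>2 s E x\<bar> \<le> \<bar>y - x\<bar> * b + \<epsilon> / 2"
    proof (cases "x \<le> y")
      case True
      then show ?thesis using close[of x y] x y by simp
    next
      case False
      then show ?thesis using close[of y x] x y by (simp add: abs_minus_commute)
    qed
    ultimately show "dist (string_value \<sigma>2 s E y) (string_value \<sigma>2 s E x) < \<epsilon>"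
      by (simp add: dist_real_def)
  qed
qed

end

section \<open>Existence of the cut-off power and of an output\<close>

context bc_problem
begin

lemma step1_exists:
  assumes "completes \<sigma>2 s E B1 B2 T' r1 r2"
  shows "\<exists>i T. step1 \<sigma>2 s E B1 B2 i T"
proof -
  have T': "0 < T'" by (rule completes_pos[OF assms B1])
  define N where "N = num_epochs s T'"
  have N: "0 < N" unfolding N_def by (rule num_epochs_pos)
  \<comment> \<open>The given policy yields only a weak inequality at \<open>N\<close>; one more
    epoch makes it strict, as Step 1 demands.\<close>
  have "const_energy \<sigma>2 B1 B2 (s (Suc N)) < const_energy \<sigma>2 B1 B2 (s N)"
    by (rule const_energy_strict_antimono[OF \<sigma>_ge B1 B2_ge s_pos[OF N]]) simp
  also have "\<dots> \<le> const_energy \<sigma>2 B1 B2 T'"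
    unfolding N_def by (rule const_energy_antimono[OF \<sigma>_ge B1 B2_ge T' le_s_num_epochs[OF T']])
  also have "\<dots> \<le> sum E {..<N}" unfolding N_def by (rule completes_const_energy[OF \<sigma>_ge assms B1])
  also have "\<dots> \<le> sum E {..<Suc N}" by (intro E_cum_mono) simp
  finally have ex: "1 \<le> Suc N \<and> const_energy \<sigma>2 B1 B2 (s (Suc N)) < sum E {..<Suc N}" by simp
  define i where "i = (LEAST i. 1 \<le> i \<and> const_energy \<sigma>2 B1 B2 (s i) < sum E {..<i})"
  have i: "1 \<le> i" "const_energy \<sigma>2 B1 B2 (s i) < sum E {..<i}"
    using LeastI[of "\<lambda>i. 1 \<le> i \<and> const_energy \<sigma>2 B1 B2 (s i) < sum E {..<i}", OF ex] unfolding i_def by auto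
  have min: "\<not> const_energy \<sigma>2 B1 B2 (s j) < sum E {..<j}" if "1 \<le> j" "j < i" for j
    using not_less_Least[of j "\<lambda>i. 1 \<le> i \<and> const_energy \<sigma>2 B1 B2 (s i) < sum E {..<i}"] that
    unfolding i_def by blast
  obtain T where "0 < T" "const_energy \<sigma>2 B1 B2 T = sum E {..<i}"
    using const_energy_solution[OF \<sigma>_ge B1 B2_ge _ _ i(2)] i(1) s_pos E_cum_pos by auto
  then show ?thesis using i min unfolding step1_def by blast
qed

lemma allocates_constant_or_step3:
  assumes "completes \<sigma>2 s E B1 B2 T' r1 r2"
  obtains (const_rates) T q1 q2 where "allocates \<sigma>2 s E B1 B2 True T q1 q2"
    | (cutoff) i1 where "reaches_step3 \<sigma>2 s E B1 B2 i1"
proof -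
  obtain i T where st: "step1 \<sigma>2 s E B1 B2 i T" using step1_exists[OF assms] by blast
  show ?thesis
  proof (cases "const_power_feasible s E T (1 / T * (\<Sum>j<i. E j))")
    case True
    then show ?thesis using const_rates allocates.constant_rates[OF st] by blast
  next
    case False
    obtain j where "0 < j" "j < i" using infeasible_corner[OF st False] by blast
    then have "{1..<i} \<noteq> {}" by auto
    then obtain i1 where "is_arg_min (avg_power s E 0) (\<lambda>j. j \<in> {1..<i}) i1"
      using ex_is_arg_min_if_finite[of "{1..<i}" "avg_power s E 0"] by auto
    then have "step2 s E i i1" by (simp add: step2_def)
    then show ?thesis using cutoff st False unfolding reaches_step3_def by blast
  qed
qed

text \<open>As the cut-off power tends to 0 the deadline tends to infinity, and eventually the energy
  \<open>sum E {..<i}\<close> of Step 1 can be spent at constant power, which suffices for more than \<open>B2\<close> bits.\<close>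
lemma small_cutoff_excess:
  assumes step3: "reaches_step3 \<sigma>2 s E B1 B2 i1"
  obtains p where "0 < p" "p < avg_power s E 0 i1" "B2 < bits2 \<sigma>2 s E (B1 / awgn_rate p) p"
proof -
  let ?P1 = "avg_power s E 0 i1"
  obtain i Tt where st: "step1 \<sigma>2 s E B1 B2 i Tt"
    and le: "\<And>j. 0 < j \<Longrightarrow> j < i \<Longrightarrow> ?P1 * s j \<le> sum E {..<j}"
    using step3E[OF step3] by blast
  note b = step1_bounds[OF st]
  have P1: "0 < ?P1" by (rule P1_pos[OF step3])
  define H where "H = sum E {..<i}"
  have H: "0 < H" unfolding H_def by (rule E_cum_pos[OF b(3)])
  \<comment> \<open>Past \<open>s i\<close>, constant rates need less than \<open>H\<close>; past
    \<open>H / ?P1\<close>, the power \<open>H / T\<close> is at most \<open>?P1\<close>, so that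
    spending it is causal at the corners below \<open>i\<close>.\<close>
  define T where "T = max (s i) (H / ?P1)"
  have T: "0 < T" "s i \<le> T" "H / ?P1 \<le> T" using s_pos[OF b(3)] by (auto simp: T_def)
  define Q where "Q = H / T"
  have Q: "0 < Q" "Q \<le> ?P1" "Q * T = H" using T H P1 by (auto simp: Q_def field_simps)
  \<comment> \<open>The power at which user 1 has rate \<open>B1 / T\<close>, so that the deadline
    induced by \<open>p\<close> is exactly \<open>T\<close>.\<close>
  define p where "p = 2 powr (2 * (B1 / T)) - 1"
  have p: "0 < p" using B1 T by (simp add: p_def)
  have rate: "awgn_rate p = B1 / T" by (rule awgn_rate_eqI) (simp add: p_def)
  then have T_eq: "B1 / awgn_rate p = T" using B1 by simp
  have "const_energy \<sigma>2 B1 B2 T \<le> const_energy \<sigma>2 B1 B2 (s i)"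
    by (rule const_energy_antimono[OF \<sigma>_ge B1 B2_ge s_pos[OF b(3)] T(2)])
  also have "\<dots> < Q * T" using st Q by (simp add: step1_def H_def)
  finally have energy: "bc_power \<sigma>2 (B1 / T) (B2 / T) < Q" using T by (simp add: const_energy_def)
  have "p = bc_power \<sigma>2 (B1 / T) 0" using rate p bc_power_user1[of p \<sigma>2] by simp
  also have "\<dots> \<le> bc_power \<sigma>2 (B1 / T) (B2 / T)" using \<sigma> B2 T by (intro bc_power_mono) auto
  finally have pQ: "p < Q" using energy by simp
  have "B2 / T < user2_rate \<sigma>2 Q p"
  proof (rule ccontr)
    assume "\<not> B2 / T < user2_rate \<sigma>2 Q p"
    then have "bc_power \<sigma>2 (awgn_rate p) (user2_rate \<sigma>2 Q p) \<le> bc_power \<sigma>2 (B1 / T) (B2 / T)"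
      using rate by (intro bc_power_mono[OF \<sigma>_ge]) auto
    moreover have "bc_power \<sigma>2 (awgn_rate p) (user2_rate \<sigma>2 Q p) = Q"
      using p pQ \<sigma> by (intro bc_power_split) auto
    ultimately show False using energy by simp
  qed
  then have "B2 < user2_rate \<sigma>2 Q p * T" using T by (simp add: divide_less_eq)
  also have "\<dots> = 1 / 2 * log 2 (Q + \<sigma>2) * T - 1 / 2 * log 2 (p + \<sigma>2) * T"
    using user2_rate_diff[of p Q \<sigma>2] p Q \<sigma> by (simp add: left_diff_distrib)
  also have "\<dots> \<le> bits2 \<sigma>2 s E T p"
  proof -
    have "(\<Sum>k<num_epochs s T. 1 / 2 * log 2 (Q + \<sigma>2) * epoch_len s T k) + 1 / 2 * log 2 \<sigma>2 * (T - T)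
      \<le> string_value \<sigma>2 s E T"
    proof (rule string_value_max)
      fix m assume m: "m \<le> num_epochs s T"
      have "(\<Sum>k<m. Q * epoch_len s T k) = Q * min (s m) T"
        using m T by (simp add: sum_distrib_left[symmetric] sum_epoch_len_initial)
      also have "\<dots> \<le> sum E {..<m}"
      proof (cases "i \<le> m")
        case True
        have "Q * min (s m) T \<le> Q * T" using Q by (intro mult_left_mono) auto
        also have "\<dots> \<le> sum E {..<m}" using E_cum_mono[OF True] Q by (simp add: H_def)
        finally show ?thesis .
      next
        case False
        have "Q * min (s m) T \<le> ?P1 * s m" using Q P1 s_nonneg[of m] T by (intro mult_mono) auto
        also have "\<dots> \<le> sum E {..<m}" using le[of m] False s_0 by (cases "m = 0") auto
        finally show ?thesis .
      qed
      finally show "(\<Sum>k<m. Q * epoch_len s T k) \<le> sum E {..<m}" .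
    qed (use \<sigma> T Q in auto)
    moreover have "(\<Sum>k<num_epochs s T. 1 / 2 * log 2 (Q + \<sigma>2) * epoch_len s T k) = 1 / 2 * log 2 (Q + \<sigma>2) * T"
      by (simp only: sum_distrib_left[symmetric] sum_epoch_len[OF T(1)])
    ultimately show ?thesis using T p \<sigma> by (simp add: bits2_string_value)
  qed
  finally show ?thesis using that[of p] p pQ Q T_eq by simp
qed

lemma cutoff_exists:
  assumes step3: "reaches_step3 \<sigma>2 s E B1 B2 i1"
    and less: "bits2 \<sigma>2 s E (B1 / awgn_rate (avg_power s E 0 i1)) (avg_power s E 0 i1) < B2"
  obtains p where "0 < p" "p < avg_power s E 0 i1" "B2 = bits2 \<sigma>2 s E (B1 / awgn_rate p) p"
proof -
  let ?P1 = "avg_power s E 0 i1" and ?f = "\<lambda>p. bits2 \<sigma>2 s E (B1 / awgn_rate p) p"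
  obtain p0 where p0: "0 < p0" "p0 < ?P1" "B2 < ?f p0" by (rule small_cutoff_excess[OF step3])
  let ?g = "\<lambda>p. string_value \<sigma>2 s E (B1 / awgn_rate p) - 1 / 2 * log 2 (p + \<sigma>2) * (B1 / awgn_rate p)"
  have fg: "?f p = ?g p" if "p \<in> {p0..?P1}" for p
    using that p0 B1 \<sigma> awgn_rate_pos[of p] by (intro bits2_string_value) auto
  have cont: "continuous_on {p0..?P1} (\<lambda>p. B1 / awgn_rate p)"
  proof (intro continuous_intros ballI)
    show "continuous_on {p0..?P1} awgn_rate"
      unfolding awgn_rate_def using p0 by (intro continuous_intros) auto
    show "awgn_rate p \<noteq> 0" if "p \<in> {p0..?P1}" for p
      using that p0 awgn_rate_pos[of p] by auto
  qed
  have "continuous_on {p0..?P1} (\<lambda>p. string_value \<sigma>2 s E (B1 / awgn_rate p))"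
  proof (rule continuous_on_compose2[OF continuous_on_string_value[OF \<sigma>, of "B1 / awgn_rate p0"] cont])
    show "(\<lambda>p. B1 / awgn_rate p) ` {p0..?P1} \<subseteq> {0<..B1 / awgn_rate p0}"
      using p0 B1 by (auto simp: awgn_rate_pos awgn_rate_le_iff intro!: divide_left_mono mult_pos_pos)
  qed
  moreover have "continuous_on {p0..?P1} (\<lambda>p. log 2 (p + \<sigma>2))"
    using p0 \<sigma> by (intro continuous_intros) auto
  ultimately have "continuous_on {p0..?P1} ?g"
    using cont by (intro continuous_on_diff continuous_on_mult continuous_on_const)
  then have "continuous_on {p0..?P1} ?f"
    by (rule continuous_on_cong[THEN iffD1, rotated 2]) (simp_all only: fg)
  then obtain p where p: "p0 \<le> p" "p \<le> ?P1" "?f p = B2"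
    using IVT2'[of ?f ?P1 B2 p0] p0 less by auto
  moreover have "p \<noteq> ?P1" using p(3) less by auto
  ultimately show ?thesis using that[of p] p0 by auto
qed

end

text \<open>The recursion terminates because the number of epochs before \<open>D\<close> shrinks.
  Passing to the continuation moves \<open>D\<close> to \<open>D - s i1\<close> and drops
  \<open>i1\<close> epochs; the new corner power is at least \<open>P1\<close>, so the new tentative
  deadline still obeys the bound.\<close>

lemma allocates_output_exists:
  assumes "bc_problem s E \<sigma>2 B1 B2" "reaches_step3 \<sigma>2 s E B1 B2 i1"
    and "B1 / awgn_rate (avg_power s E 0 i1) \<le> D"
  shows "\<exists>T r1 r2. allocates \<sigma>2 s E B1 B2 True T r1 r2"
  using assms
proof (induction "num_epochs s D" arbitrary: s E B1 i1 D rule: less_induct)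
  case less
  interpret bc_problem s E \<sigma>2 B1 B2 by (rule less.prems)
  note step3 = less.prems(2)
  define P1 where "P1 = avg_power s E 0 i1"
  define T1 where "T1 = B1 / awgn_rate P1"
  consider "bits2 \<sigma>2 s E T1 P1 = B2" | "bits2 \<sigma>2 s E T1 P1 < B2" | "B2 < bits2 \<sigma>2 s E T1 P1" by linarith
  then show ?case
  proof cases
    case 1
    then show ?thesis using allocates.tentative[OF step3 P1_def T1_def] by auto
  next
    case 2
    then obtain p where "0 < p" "p < P1" "B2 = bits2 \<sigma>2 s E (B1 / awgn_rate p) p"
      using cutoff_exists[OF step3] unfolding P1_def T1_def by blast
    then show ?thesis using allocates.step3a[OF step3 P1_def T1_def 2 _ _ refl] by blast
  next
    case 3
    note excess = 3[unfolded T1_def P1_def]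
    let ?s = "\<lambda>k. s (i1 + k) - s i1" and ?E = "\<lambda>k. E (i1 + k)" and ?B1 = "B1 - awgn_rate P1 * s i1"
    interpret sub: bc_problem ?s ?E \<sigma>2 ?B1 B2
      unfolding P1_def by (rule continuation_problem[OF step3 excess])
    obtain r2 where compl: "completes \<sigma>2 ?s ?E ?B1 B2 (T1 - s i1) (\<lambda>_. awgn_rate P1) r2"
      using continuation_completes[OF step3 excess] unfolding P1_def T1_def by blast
    have "\<exists>T r1 r2. allocates \<sigma>2 ?s ?E ?B1 B2 True T r1 r2"
    proof (rule sub.allocates_constant_or_step3[OF compl], goal_cases)
      case (2 j)
      define P1' where "P1' = avg_power ?s ?E 0 j"
      have P1: "0 < P1" unfolding P1_def by (rule P1_pos[OF step3])
      have ge: "P1 \<le> P1'"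
        using continuation_power_ge[OF step3 excess, folded P1_def, OF 2] unfolding P1'_def .
      have T1: "s i1 < T1" using s_i1_less[OF step3 excess] unfolding T1_def P1_def .
      then have D: "0 < D - s i1" using less.prems(3) unfolding T1_def P1_def by linarith
      have "?B1 / awgn_rate P1' \<le> ?B1 / awgn_rate P1"
        using ge P1 sub.B1 by (intro divide_left_mono mult_pos_pos) (auto simp: awgn_rate_pos awgn_rate_le_iff)
      also have "\<dots> = T1 - s i1"
        using continuation_bits[OF step3 excess] awgn_rate_pos[OF P1] unfolding P1_def T1_def by simp
      finally have le: "?B1 / awgn_rate P1' \<le> D - s i1" using less.prems(3) unfolding T1_def P1_def by linarith
      have "num_epochs s D = i1 + num_epochs ?s (D - s i1)"
        using num_epochs_shift[OF E_i1_pos[OF step3] D] by simp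
      then have "num_epochs ?s (D - s i1) < num_epochs s D" using i1_pos[OF step3] by simp
      then show ?case using less.hyps[OF _ sub.bc_problem_axioms 2 le[unfolded P1'_def]] by blast
    qed blast
    then show ?thesis using allocates.step3b_rest[OF step3 P1_def T1_def 3] by blast
  qed
qed


section \<open>Feasibility and optimality\<close>

lemma allocates_causal:
  assumes "allocates \<sigma>2 s E B1 B2 out T r1 r2" "bc_problem s E \<sigma>2 B1 B2"
  shows "0 < T \<and> energy_causal \<sigma>2 s E T r1 r2"
  using assms
proof (induction rule: allocates.induct)
  case (constant_rates s E B1 B2 i T)
  then interpret bc_problem s E \<sigma>2 B1 B2 by simp
  show ?case
    using constant_rates_optimal(1)[OF constant_rates(1,2)] step1_bounds(1)[OF constant_rates(1)]
    by (auto simp: completes_def)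
next
  case (tentative s E B1 B2 i1 P1 T1)
  then interpret bc_problem s E \<sigma>2 B1 B2 by simp
  note P1 = P1_pos[OF tentative(1)]
  have "0 < T1" using B1 awgn_rate_pos[OF P1] tentative by simp
  then show ?case
    using cutoff_policy_causal[OF \<sigma> _ P1 total_power_ge_cutoff[OF tentative(1) P1 order_refl refl]] tentative by simp
next
  case (step3a s E B1 B2 i1 P1 T1 Pc T)
  then interpret bc_problem s E \<sigma>2 B1 B2 by simp
  have Pc: "Pc \<le> avg_power s E 0 i1" using step3a by simp
  have "0 < T" using B1 awgn_rate_pos[OF step3a(5)] step3a by simp
  then show ?case
    using cutoff_policy_causal[OF \<sigma> _ step3a(5) total_power_ge_cutoff[OF step3a(1,5) Pc refl]] step3a by simp
next
  case (step3b_first s E B1 B2 i1 P1 T1)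
  then interpret bc_problem s E \<sigma>2 B1 B2 by simp
  note i1 = i1_pos[OF step3b_first(1)] and P1 = P1_pos[OF step3b_first(1), folded step3b_first(2)]
  have "cum_energy \<sigma>2 s (s i1) (\<lambda>_. awgn_rate P1) (\<lambda>_. 0) m \<le> sum E {..<m}" if m: "m \<le> i1" for m
  proof -
    have "cum_energy \<sigma>2 s (s i1) (\<lambda>_. awgn_rate P1) (\<lambda>_. 0) m = P1 * min (s m) (s i1)"
      unfolding cum_energy_def using P1 m
      by (simp add: bc_power_user1 num_epochs_s[OF i1] sum_epoch_len_initial[OF s_pos[OF i1]] flip: sum_distrib_left)
    then show ?thesis using P1_le[OF step3b_first(1) m] m step3b_first(2) by (simp add: min_def)
  qed
  then show ?case
    using s_pos[OF i1] P1 by (auto simp: energy_causal_iff_cum[OF _ \<sigma>_ge] num_epochs_s[OF i1] awgn_rate_nonneg)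
next
  case (step3b_rest s E B1 B2 i1 P1 T1 out T' r1 r2)
  then interpret bc_problem s E \<sigma>2 B1 B2 by simp
  note step3 = step3b_rest(1)
  have IH: "0 < T'" "energy_causal \<sigma>2 (\<lambda>k. s (i1 + k) - s i1) (\<lambda>k. E (i1 + k)) T' r1 r2"
    using step3b_rest continuation_problem[OF step3] by auto
  have "energy_causal \<sigma>2 s E (s i1 + T') (\<lambda>k. if k < i1 then awgn_rate P1 else r1 (k - i1))
      (\<lambda>k. if k < i1 then 0 else r2 (k - i1))"
    using P1_le[OF step3] step3b_rest(2)
    by (intro energy_causal_concat[OF E_i1_pos[OF step3] IH(1) _ \<sigma>_ge IH(2)]) (auto simp: P1_pos[OF step3])
  then show ?case using IH(1) s_nonneg[of i1] by simp
qed

text \<open>The last conjunct describes the first rate of user 1, which the induction needs to compare the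
  first multiplier with that of a preceding interval.\<close>
lemma allocates_certificate:
  assumes "allocates \<sigma>2 s E B1 B2 out T r1 r2" out "bc_problem s E \<sigma>2 B1 B2"
  shows "completes \<sigma>2 s E B1 B2 T r1 r2 \<and>
    (\<exists>\<rho> \<mu>. cutoff_certificate \<sigma>2 s E T r1 r2 \<rho> \<mu> \<and>
       (r1 0 = \<rho> \<or> (\<exists>i1. reaches_step3 \<sigma>2 s E B1 B2 i1 \<and> r1 0 = awgn_rate (avg_power s E 0 i1))))"
  using assms
proof (induction rule: allocates.induct)
  case (constant_rates s E B1 B2 i T)
  then interpret bc_problem s E \<sigma>2 B1 B2 by simp
  show ?case using constant_rates_optimal[OF constant_rates(1,2)] by blast
next
  case (tentative s E B1 B2 i1 P1 T1)
  then interpret bc_problem s E \<sigma>2 B1 B2 by simp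
  note P1 = P1_pos[OF tentative(1), folded tentative(2)]
  have T1: "0 < T1" using B1 awgn_rate_pos[OF P1] tentative by simp
  note pol = cutoff_policy[OF \<sigma> T1 P1 total_power_ge_cutoff[OF tentative(1) P1 eq_refl[OF tentative(2)] tentative(3)]]
  have "awgn_rate P1 * T1 = B1" using awgn_rate_pos[OF P1] tentative by simp
  then have "completes \<sigma>2 s E B1 B2 T1 (\<lambda>_. awgn_rate P1) (\<lambda>k. user2_rate \<sigma>2 (total_power s E T1 k) P1)"
    using pol(2,3,4) T1 tentative(4) by (simp add: completes_def)
  then show ?case using pol(5) by blast
next
  case (step3a s E B1 B2 i1 P1 T1 Pc T)
  then interpret bc_problem s E \<sigma>2 B1 B2 by simp
  have Pc: "Pc \<le> avg_power s E 0 i1" using step3a by simp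
  have T: "0 < T" using B1 awgn_rate_pos[OF step3a(5)] step3a by simp
  note pol = cutoff_policy[OF \<sigma> T step3a(5) total_power_ge_cutoff[OF step3a(1,5) Pc step3a(7)]]
  have "awgn_rate Pc * T = B1" using awgn_rate_pos[OF step3a(5)] step3a(7) by simp
  then have "completes \<sigma>2 s E B1 B2 T (\<lambda>_. awgn_rate Pc) (\<lambda>k. user2_rate \<sigma>2 (total_power s E T k) Pc)"
    using pol(2,3,4) T step3a(8) by (simp add: completes_def)
  then show ?case using pol(5) by blast
next
  case (step3b_first s E B1 B2 i1 P1 T1)
  then show ?case by simp
next
  case (step3b_rest s E B1 B2 i1 P1 T1 out T' r1 r2)
  then interpret bc_problem s E \<sigma>2 B1 B2 by simp
  note step3 = step3b_rest(1)
  note excess = step3b_rest(4)[unfolded step3b_rest(3) step3b_rest(2)]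
  let ?s = "\<lambda>k. s (i1 + k) - s i1" and ?E = "\<lambda>k. E (i1 + k)" and ?B1 = "B1 - awgn_rate P1 * s i1"
  interpret sub: bc_problem ?s ?E \<sigma>2 ?B1 B2
    unfolding step3b_rest(2) by (rule continuation_problem[OF step3 excess])
  note P1 = P1_pos[OF step3, folded step3b_rest(2)]
  have IH: "completes \<sigma>2 ?s ?E ?B1 B2 T' r1 r2"
    "\<exists>\<rho> \<mu>. cutoff_certificate \<sigma>2 ?s ?E T' r1 r2 \<rho> \<mu> \<and>
       (r1 0 = \<rho> \<or> (\<exists>j. reaches_step3 \<sigma>2 ?s ?E ?B1 B2 j \<and> r1 0 = awgn_rate (avg_power ?s ?E 0 j)))"
    using step3b_rest.IH step3b_rest.prems(1) sub.bc_problem_axioms by auto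
  then obtain \<rho> \<mu> where cert: "cutoff_certificate \<sigma>2 ?s ?E T' r1 r2 \<rho> \<mu>"
    and r1_0: "r1 0 = \<rho> \<or> (\<exists>j. reaches_step3 \<sigma>2 ?s ?E ?B1 B2 j \<and> r1 0 = awgn_rate (avg_power ?s ?E 0 j))"
    by blast
  have T': "0 < T'" by (rule sub.completes_pos[OF IH(1) sub.B1])
  have causal: "energy_causal \<sigma>2 ?s ?E T' r1 r2" using IH(1) by (simp add: completes_def)
  obtain q2 where "completes \<sigma>2 ?s ?E ?B1 B2 (T1 - s i1) (\<lambda>_. awgn_rate P1) q2"
    using continuation_completes[OF step3 excess] unfolding step3b_rest(2,3) by blast
  then have T'_le: "T' \<le> T1 - s i1"
    by (rule sub.certificate_optimal[OF \<sigma>_ge sub.B1 cert IH(1)])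
  \<comment> \<open>User 1 needs the same bits in time \<open>T'\<close> as at rate
    \<open>awgn_rate P1\<close> in the possibly longer time \<open>T1 - s i1\<close>; the mean rate,
    and with it the maximum \<open>\<rho>\<close>, is at least \<open>awgn_rate P1\<close>.\<close>
  have "awgn_rate P1 * T' \<le> awgn_rate P1 * (T1 - s i1)"
    using T'_le awgn_rate_pos[OF P1] by simp
  also have "\<dots> = ?B1"
    using continuation_bits[OF step3 excess] unfolding step3b_rest(2,3) by simp
  also have "\<dots> = (\<Sum>k<num_epochs ?s T'. r1 k * epoch_len ?s T' k)"
    using IH(1) sub.delivered_eq[OF T', of r1] by (simp add: completes_def)
  also have "\<dots> \<le> (\<Sum>k<num_epochs ?s T'. \<rho> * epoch_len ?s T' k)"
    using cert by (intro sum_mono mult_right_mono) (auto simp: cutoff_certificate_def)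
  also have "\<dots> = \<rho> * T'" by (simp only: sum_distrib_left[symmetric] sub.sum_epoch_len[OF T'])
  finally have \<rho>: "awgn_rate P1 \<le> \<rho>" using T' by simp
  \<comment> \<open>The continuation starts either at its cut-off rate, just bounded, or at the
    power of its own first corner.\<close>
  have r1_0_ge: "awgn_rate P1 \<le> r1 0"
    using r1_0
  proof (elim disjE exE conjE)
    fix j assume j: "reaches_step3 \<sigma>2 ?s ?E ?B1 B2 j" and eq: "r1 0 = awgn_rate (avg_power ?s ?E 0 j)"
    have "P1 \<le> avg_power ?s ?E 0 j"
      using continuation_power_ge[OF step3 excess, folded step3b_rest(2), OF j] .
    then show ?thesis using P1 by (simp add: eq awgn_rate_le_iff)
  qed (use \<rho> in simp)
  let ?r1 = "\<lambda>k. if k < i1 then awgn_rate P1 else r1 (k - i1)"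
  let ?r2 = "\<lambda>k. if k < i1 then 0 else r2 (k - i1)"
  have "energy_causal \<sigma>2 s E (s i1 + T') ?r1 ?r2"
    using P1_le[OF step3] step3b_rest(2)
    by (intro energy_causal_concat[OF E_i1_pos[OF step3] T' P1 \<sigma>_ge causal]) auto
  moreover have "delivered s ?r1 (s i1 + T') = B1" "delivered s ?r2 (s i1 + T') = B2"
    using IH(1) delivered_concat[OF E_i1_pos[OF step3] T' P1] by (auto simp: completes_def)
  ultimately have "completes \<sigma>2 s E B1 B2 (s i1 + T') ?r1 ?r2"
    using T' s_nonneg[of i1] by (simp add: completes_def)
  moreover have "\<exists>\<mu>. cutoff_certificate \<sigma>2 s E (s i1 + T') ?r1 ?r2 \<rho> \<mu>"
    using certificate_concat[OF E_i1_pos[OF step3] T' P1 \<sigma> causal cert _ \<rho> r1_0_ge]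
      P1_eq[OF step3] step3b_rest(2) by simp
  moreover have "?r1 0 = awgn_rate (avg_power s E 0 i1)" using i1_pos[OF step3] step3b_rest(2) by simp
  ultimately show ?case using step3 by blast
qed

theorem theorem1:
  fixes \<sigma>2 B1 B2 :: real and s E :: "nat \<Rightarrow> real"
  assumes noise: "\<sigma>2 > 1"
    and bits: "B1 > 0" "B2 > 0"
    and arrivals: "s 0 = 0" "strict_mono s" "\<And>T. finite {k. s k < T}"
    and energies: "E 0 > 0" "\<And>k. E k \<ge> 0"
  shows
    "(\<forall>out T r1 r2. allocates \<sigma>2 s E B1 B2 out T r1 r2 \<longrightarrow> energy_causal \<sigma>2 s E T r1 r2) \<and>
     ((\<exists>T r1 r2. completes \<sigma>2 s E B1 B2 T r1 r2) \<longrightarrow>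
        (\<exists>T r1 r2. allocates \<sigma>2 s E B1 B2 True T r1 r2)) \<and>
     (\<forall>T r1 r2. allocates \<sigma>2 s E B1 B2 True T r1 r2 \<longrightarrow>
        completes \<sigma>2 s E B1 B2 T r1 r2 \<and> is_min_completion_time \<sigma>2 s E B1 B2 T)"
proof -
  interpret bc_problem s E \<sigma>2 B1 B2
    by unfold_locales (use assms in auto)
  show ?thesis
  proof (intro conjI allI impI)
    fix out T r1 r2 assume "allocates \<sigma>2 s E B1 B2 out T r1 r2"
    then show "energy_causal \<sigma>2 s E T r1 r2" using allocates_causal bc_problem_axioms by blast
  next
    assume "\<exists>T r1 r2. completes \<sigma>2 s E B1 B2 T r1 r2"
    then obtain T r1 r2 where "completes \<sigma>2 s E B1 B2 T r1 r2" by blast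
    then show "\<exists>T r1 r2. allocates \<sigma>2 s E B1 B2 True T r1 r2"
      by (rule allocates_constant_or_step3)
        (blast intro: allocates_output_exists[OF bc_problem_axioms _ order_refl])+
  next
    fix T r1 r2 assume out: "allocates \<sigma>2 s E B1 B2 True T r1 r2"
    note cert = allocates_certificate[OF out TrueI bc_problem_axioms]
    then show completes: "completes \<sigma>2 s E B1 B2 T r1 r2" by blast
    show "is_min_completion_time \<sigma>2 s E B1 B2 T"
      unfolding is_min_completion_time_def using cert certificate_optimal[OF \<sigma>_ge B1] by blast
  qed
qed

end
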